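(* Let $\mathcal H_1,\mathcal H_2$ be Hilbert spaces. (i) If $\dim\mathcal H_1<\infty$, then every $\theta\in B(\mathcal H_1,F^2(H_n)\otimes\mathcal H_2)$ factors as $\theta=M_\chi\psi$, where $\psi\in B(\mathcal H_1,F^2(H_n)\otimes\mathcal H_3)$ is outer and $M_\chi\in R_n^\infty\bar\otimes B(\mathcal H_3,\mathcal H_2)$ is inner, for some Hilbert space $\mathcal H_3$; the factorization is unique up to a unitary constant: if also $\theta=M_{\chi'}\psi'$ with $\psi'\in B(\mathcal H_1,F^2(H_n)\otimes\mathcal H_3')$ outer and $M_{\chi'}$ inner, then there is a unitary $U:\mathcal H_3\to\mathcal H_3'$ with $\psi'=(I\otimes U)\psi$ and $M_\chi=M_{\chi'}(I\otimes U)$. (ii) If $\mathcal H_1$ is arbitrary and $M_\theta\in R_n^\infty\bar\otimes B(\mathcal H_1,\mathcal H_2)$, then there exist a Hilbert space $\mathcal H_3$, an outer $M_\psi\in R_n^\infty\bar\otimes B(\mathcal H_1,\mathcal H_3)$ and an inner $M_\chi\in R_n^\infty\bar\otimes B(\mathcal H_3,\mathcal H_2)$ with $M_\theta=M_\chi M_\psi$; this factorization is unique up to a unitary constant in the same sense as in (i).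
   Context: Full Fock space $F^2(H_n)$ with basis $e_\alpha$, $\alpha\in\mathbb F_n^+$; $S_i\psi=e_i\otimes\psi$, $S_\alpha$ products. $R_n^\infty\bar\otimes B(\mathcal K,\mathcal K')$ denotes the set of multi-analytic operators, i.e. bounded $M:F^2(H_n)\otimes\mathcal K\to F^2(H_n)\otimes\mathcal K'$ with $M(S_i\otimes I_{\mathcal K})=(S_i\otimes I_{\mathcal K'})M$ for all $i$. $M$ is inner if it is an isometry. A bounded operator $\psi\in B(\mathcal H,F^2(H_n)\otimes\mathcal K)$ is outer if $\bigvee_{\alpha\in\mathbb F_n^+}(S_\alpha\otimes I_{\mathcal K})\psi\mathcal H=F^2(H_n)\otimes\mathcal K$; a multi-analytic $M_\psi$ is outer if its symbol $\psi:h\mapsto M_\psi(1\otimes h)$ is outer. $M_\chi\psi$ denotes composition. *)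

theory Defs
  imports "HOL-Analysis.Analysis"
begin

text \<open>A complex Hilbert space is modelled as a real Hilbert space together with an
orthogonal complex structure cJ (multiplication by the imaginary unit).
Complex scalar multiplication is cscale c x = Re c *R x + Im c *R cJ x.\<close>

class chilbert = real_inner + complete_space +
  fixes cJ :: "'a \<Rightarrow> 'a"
  assumes cJ_add: "cJ (x + y) = cJ x + cJ y"
    and cJ_scaleR: "cJ (r *\<^sub>R x) = r *\<^sub>R cJ x"
    and cJ_cJ: "cJ (cJ x) = - x"
    and cJ_inner: "inner (cJ x) (cJ y) = inner x y"

definition cscale :: "complex \<Rightarrow> 'a::chilbert \<Rightarrow> 'a" where
  "cscale c x = Re c *\<^sub>R x + Im c *\<^sub>R cJ x"

definition csubspace :: "'a::chilbert set \<Rightarrow> bool" where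
  "csubspace K \<longleftrightarrow> subspace K \<and> (\<forall>x\<in>K. cJ x \<in> K) \<and> closed K"

definition lin_on :: "'a::chilbert set \<Rightarrow> ('a \<Rightarrow> 'b::chilbert) \<Rightarrow> bool" where
  "lin_on K T \<longleftrightarrow> (\<forall>x\<in>K. \<forall>y\<in>K. T (x + y) = T x + T y)
     \<and> (\<forall>x\<in>K. \<forall>r. T (r *\<^sub>R x) = r *\<^sub>R T x)
     \<and> (\<forall>x\<in>K. T (cJ x) = cJ (T x))"

definition unitary_on :: "'a::chilbert set \<Rightarrow> 'b::chilbert set \<Rightarrow> ('a \<Rightarrow> 'b) \<Rightarrow> bool" where
  "unitary_on K K' U \<longleftrightarrow> lin_on K U \<and> U ` K = K' \<and> (\<forall>x\<in>K. norm (U x) = norm x)"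

text \<open>Words of the free monoid on n generators 0,...,n-1.  An element of
F^2(H_n) \<otimes> K is identified with its coefficient function
w \<mapsto> (component at e_w), i.e. f = \<Sum>_w e_w \<otimes> f w.\<close>

definition words :: "nat \<Rightarrow> nat list set" where
  "words n = {w. set w \<subseteq> {..<n}}"

definition fock :: "nat \<Rightarrow> 'k::chilbert set \<Rightarrow> (nat list \<Rightarrow> 'k) set" where
  "fock n K = {f. (\<forall>w. f w \<in> K) \<and> (\<forall>w. w \<notin> words n \<longrightarrow> f w = 0)
                 \<and> (\<lambda>w. (norm (f w))\<^sup>2) summable_on UNIV}"

definition fnorm :: "(nat list \<Rightarrow> 'k::chilbert) \<Rightarrow> real" where
  "fnorm f = sqrt (infsum (\<lambda>w. (norm (f w))\<^sup>2) UNIV)"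

text \<open>S_i \<otimes> I : e_w \<otimes> h \<mapsto> e_{i w} \<otimes> h.\<close>
definition shift :: "nat \<Rightarrow> (nat list \<Rightarrow> 'k::chilbert) \<Rightarrow> (nat list \<Rightarrow> 'k)" where
  "shift i f = (\<lambda>w. case w of [] \<Rightarrow> 0 | j # v \<Rightarrow> (if j = i then f v else 0))"

text \<open>S_\<alpha> \<otimes> I : e_w \<otimes> h \<mapsto> e_{\<alpha> w} \<otimes> h.\<close>
definition shiftw :: "nat list \<Rightarrow> (nat list \<Rightarrow> 'k::chilbert) \<Rightarrow> (nat list \<Rightarrow> 'k)" where
  "shiftw \<alpha> f = (\<lambda>w. if take (length \<alpha>) w = \<alpha> then f (drop (length \<alpha>) w) else 0)"

definition vac :: "'k::chilbert \<Rightarrow> (nat list \<Rightarrow> 'k)" where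
  "vac h = (\<lambda>w. if w = [] then h else 0)"

definition symop :: "nat \<Rightarrow> 'x::chilbert set \<Rightarrow> 'k::chilbert set \<Rightarrow> ('x \<Rightarrow> nat list \<Rightarrow> 'k) \<Rightarrow> bool" where
  "symop n H K \<psi> \<longleftrightarrow> (\<forall>x\<in>H. \<psi> x \<in> fock n K)
     \<and> (\<forall>x\<in>H. \<forall>y\<in>H. \<psi> (x + y) = (\<lambda>w. \<psi> x w + \<psi> y w))
     \<and> (\<forall>x\<in>H. \<forall>r. \<psi> (r *\<^sub>R x) = (\<lambda>w. r *\<^sub>R \<psi> x w))
     \<and> (\<forall>x\<in>H. \<psi> (cJ x) = (\<lambda>w. cJ (\<psi> x w)))
     \<and> (\<exists>C. \<forall>x\<in>H. fnorm (\<psi> x) \<le> C * norm x)"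

definition fop :: "nat \<Rightarrow> 'x::chilbert set \<Rightarrow> 'k::chilbert set
                    \<Rightarrow> ((nat list \<Rightarrow> 'x) \<Rightarrow> (nat list \<Rightarrow> 'k)) \<Rightarrow> bool" where
  "fop n K1 K2 M \<longleftrightarrow> (\<forall>f\<in>fock n K1. M f \<in> fock n K2)
     \<and> (\<forall>f\<in>fock n K1. \<forall>g\<in>fock n K1. M (\<lambda>w. f w + g w) = (\<lambda>w. M f w + M g w))
     \<and> (\<forall>f\<in>fock n K1. \<forall>r. M (\<lambda>w. r *\<^sub>R f w) = (\<lambda>w. r *\<^sub>R M f w))
     \<and> (\<forall>f\<in>fock n K1. M (\<lambda>w. cJ (f w)) = (\<lambda>w. cJ (M f w)))
     \<and> (\<exists>C. \<forall>f\<in>fock n K1. fnorm (M f) \<le> C * fnorm f)"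

text \<open>Multi-analytic operators, i.e. elements of R_n^\<infinity> \<otimes> B(K1,K2).\<close>
definition multi_analytic :: "nat \<Rightarrow> 'x::chilbert set \<Rightarrow> 'k::chilbert set
                    \<Rightarrow> ((nat list \<Rightarrow> 'x) \<Rightarrow> (nat list \<Rightarrow> 'k)) \<Rightarrow> bool" where
  "multi_analytic n K1 K2 M \<longleftrightarrow> fop n K1 K2 M
     \<and> (\<forall>i<n. \<forall>f\<in>fock n K1. M (shift i f) = shift i (M f))"

definition inner_op :: "nat \<Rightarrow> 'x::chilbert set \<Rightarrow> 'k::chilbert set
                    \<Rightarrow> ((nat list \<Rightarrow> 'x) \<Rightarrow> (nat list \<Rightarrow> 'k)) \<Rightarrow> bool" where
  "inner_op n K1 K2 M \<longleftrightarrow> multi_analytic n K1 K2 M \<and> (\<forall>f\<in>fock n K1. fnorm (M f) = fnorm f)"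

definition symbol :: "((nat list \<Rightarrow> 'x::chilbert) \<Rightarrow> (nat list \<Rightarrow> 'k)) \<Rightarrow> 'x \<Rightarrow> nat list \<Rightarrow> 'k" where
  "symbol M = (\<lambda>h. M (vac h))"

definition fspan :: "(nat list \<Rightarrow> 'k::chilbert) set \<Rightarrow> (nat list \<Rightarrow> 'k) set" where
  "fspan S = {(\<lambda>w. \<Sum>i\<in>I. cscale (c i) (v i w)) | (I :: nat set) c v. finite I \<and> (\<forall>i\<in>I. v i \<in> S)}"

definition closed_fspan :: "nat \<Rightarrow> 'k::chilbert set \<Rightarrow> (nat list \<Rightarrow> 'k) set \<Rightarrow> (nat list \<Rightarrow> 'k) set" where
  "closed_fspan n K S = {f \<in> fock n K. \<forall>\<epsilon>>0. \<exists>g\<in>fspan S. fnorm (\<lambda>w. f w - g w) < \<epsilon>}"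

definition outer :: "nat \<Rightarrow> 'x::chilbert set \<Rightarrow> 'k::chilbert set \<Rightarrow> ('x \<Rightarrow> nat list \<Rightarrow> 'k) \<Rightarrow> bool" where
  "outer n H K \<psi> \<longleftrightarrow> closed_fspan n K (\<Union>\<alpha>\<in>words n. shiftw \<alpha> ` \<psi> ` H) = fock n K"

end

theory Submission
  imports Defs
begin

text \<open>Let \<open>N\<close> be the closed invariant subspace generated by the range of the symbol \<open>\<theta>\<close>, let \<open>R\<close> be the closed
  span of its images under the shifts, and let \<open>W\<close> be the orthogonal complement of \<open>R\<close> in \<open>N\<close>. By the Wold
  decomposition \<open>N\<close> is the orthogonal sum of the images of \<open>W\<close> under all words, so an isometry \<open>V\<close> from a
  Hilbert space \<open>K\<close> onto \<open>W\<close> extends to an inner operator with range \<open>N\<close>; pulling \<open>\<theta>\<close> back along it gives the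
  outer factor. Since \<open>W\<close> is the closed range of the compression of \<open>\<theta>\<close> to \<open>W\<close>, the polar decomposition
  realises \<open>K\<close> as a closed subspace of the domain of \<open>\<theta>\<close>, of whatever dimension. For uniqueness, two
  inner factors have the same range \<open>N\<close>, so they differ by a unitary commuting with the shifts; such a
  unitary preserves the vacuum component and is therefore constant.\<close>

section \<open>Hilbert space preliminaries\<close>

text \<open>The statement asks for \<open>K3\<close> as a set in the type \<open>'a\<close> of the
  domain, whereas the wandering subspace consists of Fock space elements over \<open>'b\<close>. An
  isometry from a closed subspace of \<open>'a\<close> onto \<open>W\<close> therefore has to be
  produced, and this is the purpose of the polar decomposition: an operator and its absolute value
  have equal norms at every vector, so the closures of their ranges are isometric, and the absolute
  value acts inside \<open>'a\<close>. Its square root comes from a power series, so no spectral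
  theory enters. The inner product is real-valued and stands for the real part of a complex one.
  Against a subspace stable under \<open>cJ\<close>, real orthogonality already means complex
  orthogonality, so projections and Riesz representation are carried out over the reals and
  compatibility with \<open>cJ\<close> is checked separately. Elements of the Fock space are given
  as functions. The analysis takes place in a type of square-summable families, where closures and
  limits make sense, and \<open>coef\<close> and \<open>Abs_l2\<close> carry the results
  back.\<close>

instance chilbert \<subseteq> banach ..

lemma cJ_linear: "linear (cJ :: 'a::chilbert \<Rightarrow> 'a)"
  by (rule linearI) (simp_all add: cJ_add cJ_scaleR)

lemmas cJ_0 = linear_0[OF cJ_linear]
  and cJ_diff = linear_diff[OF cJ_linear]
  and cJ_sum = linear_sum[OF cJ_linear]

lemma norm_cJ [simp]: "norm (cJ (x::'a::chilbert)) = norm x"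
  by (simp add: norm_eq_sqrt_inner cJ_inner)

text \<open>An isometry with square -1 is skew-adjoint. This moves \<open>cJ\<close> across
  orthogonality relations and gives complex linearity of projections and Gram operators.\<close>

lemma inner_cJ_left: "inner (cJ x) y = - inner x (cJ (y::'a::chilbert))"
  using cJ_inner[of x "cJ y"] by (simp add: cJ_cJ)

lemma bounded_linear_cJ: "bounded_linear (cJ :: 'a::chilbert \<Rightarrow> 'a)"
  by (rule bounded_linear_intro[where K=1]) (simp_all add: cJ_add cJ_scaleR)

lemma continuous_on_cJ: "continuous_on A (cJ :: 'a::chilbert \<Rightarrow> 'a)"
  by (simp add: bounded_linear_cJ linear_continuous_on)

lemma csubspaceD:
  assumes "csubspace K"
  shows "subspace K" "closed K" "x \<in> K \<Longrightarrow> cJ x \<in> K"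
  using assms by (auto simp: csubspace_def)

lemma subspace_closure:
  fixes S :: "'a::real_normed_vector set"
  assumes S: "subspace S"
  shows "subspace (closure S)"
  unfolding subspace_def
proof (intro conjI ballI allI)
  show "0 \<in> closure S" using subspace_0[OF S] closure_subset by blast
next
  fix x y assume "x \<in> closure S" "y \<in> closure S"
  then obtain s t where "\<forall>k. s k \<in> S" "s \<longlonglongrightarrow> x" "\<forall>k. t k \<in> S" "t \<longlonglongrightarrow> y"
    by (meson closure_sequential)
  thus "x + y \<in> closure S"
    using tendsto_add[of s x sequentially t y] subspace_add[OF S] unfolding closure_sequential
    by (intro exI[of _ "\<lambda>k. s k + t k"]) auto
next
  fix c x assume "x \<in> closure S"
  then obtain s where "\<forall>k. s k \<in> S" "s \<longlonglongrightarrow> x" by (meson closure_sequential)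
  thus "c *\<^sub>R x \<in> closure S"
    using tendsto_scaleR[OF tendsto_const, of s x sequentially c] subspace_scale[OF S]
    unfolding closure_sequential by (intro exI[of _ "\<lambda>k. c *\<^sub>R s k"]) auto
qed

text \<open>For a \<open>cJ\<close>-stable set the real span is already the complex span, and
  continuity of \<open>cJ\<close> passes the stability on to the closure.\<close>

lemma csubspace_closure_span:
  fixes S :: "'a::chilbert set"
  assumes "\<And>x. x \<in> S \<Longrightarrow> cJ x \<in> S"
  shows "csubspace (closure (span S))"
proof -
  have "cJ ` span S = span (cJ ` S)"
    by (rule linear_span_image[OF cJ_linear, symmetric])
  also have "\<dots> \<subseteq> span S"
    using assms by (intro span_mono) auto
  finally have "cJ ` span S \<subseteq> span S" .
  hence "cJ ` span S \<subseteq> closure (span S)"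
    using closure_subset by blast
  hence "cJ ` closure (span S) \<subseteq> closure (span S)"
    by (intro image_closure_subset continuous_on_cJ) auto
  thus ?thesis
    by (auto simp: csubspace_def subspace_span subspace_closure)
qed

section \<open>Complex linear maps on subspaces\<close>

lemma lin_onD:
  assumes "lin_on K T"
  shows "x \<in> K \<Longrightarrow> y \<in> K \<Longrightarrow> T (x + y) = T x + T y"
    and "x \<in> K \<Longrightarrow> T (r *\<^sub>R x) = r *\<^sub>R T x"
    and "x \<in> K \<Longrightarrow> T (cJ x) = cJ (T x)"
  using assms by (auto simp: lin_on_def)

lemma lin_on_subset: "lin_on K T \<Longrightarrow> L \<subseteq> K \<Longrightarrow> lin_on L T"
  unfolding lin_on_def by blast

lemma lin_on_0: "lin_on K T \<Longrightarrow> 0 \<in> K \<Longrightarrow> T 0 = 0"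
  using lin_onD(2)[of K T 0 0] by simp

lemma lin_on_diff:
  assumes "lin_on K T" "subspace K" "x \<in> K" "y \<in> K"
  shows "T (x - y) = T x - T y"
proof -
  have "T (x - y) + T y = T x"
    using lin_onD(1)[OF assms(1), of "x - y" y] assms by (simp add: subspace_diff)
  thus ?thesis by (simp add: algebra_simps)
qed

lemma lin_on_sum:
  assumes "lin_on K T" "subspace K" "\<And>i. i \<in> I \<Longrightarrow> f i \<in> K"
  shows "T (\<Sum>i\<in>I. f i) = (\<Sum>i\<in>I. T (f i))"
proof (cases "finite I")
  case True
  thus ?thesis using assms(3)
  proof (induction I)
    case empty
    show ?case using assms(1,2) by (simp add: lin_on_0 subspace_0)
  next
    case (insert a F)
    have "(\<Sum>i\<in>F. f i) \<in> K"
      using insert.prems assms(2) by (intro subspace_sum) auto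
    thus ?case using insert lin_onD(1)[OF assms(1)] by simp
  qed
qed (use assms in \<open>simp add: lin_on_0 subspace_0\<close>)

lemma norm_add_sq: "(norm (x + y))\<^sup>2 = (norm x)\<^sup>2 + 2 * inner x y + (norm (y::'a::real_inner))\<^sup>2"
  by (simp add: power2_norm_eq_inner inner_add_left inner_add_right inner_commute)

lemma norm_diff_sq: "(norm (x - y))\<^sup>2 = (norm x)\<^sup>2 - 2 * inner x y + (norm (y::'a::real_inner))\<^sup>2"
  by (simp add: power2_norm_eq_inner inner_diff_left inner_diff_right inner_commute)

lemma lin_on_isometric_inner:
  assumes T: "lin_on K T" and K: "subspace K" and iso: "\<And>x. x \<in> K \<Longrightarrow> norm (T x) = norm x"
    and xy: "x \<in> K" "y \<in> K"
  shows "inner (T x) (T y) = inner x y"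
proof -
  have "(norm (T x + T y))\<^sup>2 = (norm (x + y))\<^sup>2"
    using lin_onD(1)[OF T xy] iso[of "x + y"] K xy by (simp add: subspace_add)
  thus ?thesis
    using iso xy by (simp add: norm_add_sq)
qed

lemma lin_on_isometric_inj_on:
  assumes T: "lin_on K T" and K: "subspace K" and iso: "\<And>x. x \<in> K \<Longrightarrow> norm (T x) = norm x"
  shows "inj_on T K"
proof (rule inj_onI)
  fix x y assume xy: "x \<in> K" "y \<in> K" "T x = T y"
  hence "norm (x - y) = 0"
    using iso[of "x - y"] lin_on_diff[OF T K] K by (simp add: subspace_diff)
  thus "x = y" by simp
qed

text \<open>\<open>N\<close> is injective on \<open>B\<close>, so \<open>Z\<close> must be the
  inverse of \<open>N\<close> after \<open>M\<close>, and its linearity follows by cancelling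
  \<open>N\<close>. The outer factor arises in this way, and so does the map comparing two inner
  factors.\<close>

lemma lin_on_factor:
  assumes M: "lin_on A M" and A: "csubspace A" and N: "lin_on B N" and B: "csubspace B"
    and iso: "\<And>x. x \<in> B \<Longrightarrow> norm (N x) = norm x" and sub: "M ` A \<subseteq> N ` B"
  obtains Z where "lin_on A Z" "\<And>x. x \<in> A \<Longrightarrow> Z x \<in> B" "\<And>x. x \<in> A \<Longrightarrow> N (Z x) = M x"
    "\<And>x. x \<in> A \<Longrightarrow> norm (Z x) = norm (M x)"
proof -
  define Z where "Z x = inv_into B N (M x)" for x
  have Z: "Z x \<in> B" "N (Z x) = M x" if "x \<in> A" for x
  proof -
    have "M x \<in> N ` B" using that sub by blast
    thus "Z x \<in> B" "N (Z x) = M x" by (auto simp: Z_def inv_into_into f_inv_into_f)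
  qed
  have inj: "u = v" if "u \<in> B" "v \<in> B" "N u = N v" for u v
    using inj_onD[OF lin_on_isometric_inj_on[OF N csubspaceD(1)[OF B] iso]] that by blast
  note cl = subspace_add[OF csubspaceD(1)[OF A]] subspace_scale[OF csubspaceD(1)[OF A]] csubspaceD(3)[OF A]
    subspace_add[OF csubspaceD(1)[OF B]] subspace_scale[OF csubspaceD(1)[OF B]] csubspaceD(3)[OF B]
  have "lin_on A Z"
    unfolding lin_on_def
    by (intro conjI ballI allI; rule inj) (simp_all add: Z cl lin_onD[OF M] lin_onD[OF N])
  moreover have "norm (Z x) = norm (M x)" if "x \<in> A" for x
    using iso[OF Z(1)[OF that]] Z(2)[OF that] by simp
  ultimately show ?thesis using that Z by blast
qed

section \<open>Orthogonal projection and Riesz representation\<close>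

text \<open>The parabola vanishes at \<open>t = 0\<close>, so nonnegativity makes 0 a minimum and
  its slope there must be zero; the test point \<open>a/b\<close> is the vertex. This is the
  first-order condition for a nearest point of a subspace.\<close>

lemma quadratic_nonneg_imp_zero:
  fixes a b :: real
  assumes "\<And>t. 0 \<le> t\<^sup>2 * b - 2 * t * a"
  shows "a = 0"
proof (cases "b = 0")
  case True
  thus ?thesis using assms[of a] by (simp add: power2_eq_square[symmetric])
next
  case False
  have "0 \<le> b - 2 * a" "0 \<le> b + 2 * a" using assms[of 1] assms[of "-1"] by auto
  hence "b > 0" using False by simp
  have "(a/b)\<^sup>2 * b - 2 * (a/b) * a = - (a\<^sup>2 / b)"
    using \<open>b > 0\<close> by (simp add: field_simps power2_eq_square)
  hence "a\<^sup>2 / b \<le> 0" using assms[of "a/b"] by simp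
  hence "a\<^sup>2 \<le> 0" using \<open>b > 0\<close> by (simp add: divide_le_0_iff)
  thus ?thesis by simp
qed

text \<open>A minimising sequence is Cauchy by the parallelogram law.\<close>

lemma orthogonal_projection_exists:
  fixes K :: "'a::chilbert set"
  assumes K: "subspace K" "closed K"
  shows "\<exists>p\<in>K. \<forall>y\<in>K. inner (x - p) y = 0"
proof -
  define D where "D = (\<lambda>y. (norm (x - y))\<^sup>2) ` K"
  define d where "d = Inf D"
  have bdd: "bdd_below D" unfolding D_def by (rule bdd_belowI[of _ 0]) auto
  have "0 \<in> K" using K by (simp add: subspace_0)
  hence ne: "D \<noteq> {}" by (auto simp: D_def)
  have d_le: "d \<le> (norm (x - y))\<^sup>2" if "y \<in> K" for y
    unfolding d_def by (rule cInf_lower[OF _ bdd]) (use that in \<open>auto simp: D_def\<close>)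
  have "\<exists>y\<in>K. (norm (x - y))\<^sup>2 < d + inverse (real (Suc k))" for k
    using cInf_lessD[OF ne, of "d + inverse (real (Suc k))"] by (auto simp: D_def d_def)
  then obtain y where yK: "\<And>k. y k \<in> K"
    and y: "\<And>k. (norm (x - y k))\<^sup>2 < d + inverse (real (Suc k))"
    by metis
  have par: "(norm (y m - y k))\<^sup>2 \<le> 2 * inverse (real (Suc m)) + 2 * inverse (real (Suc k))" for m k
  proof -
    have "(1/2) *\<^sub>R (y m + y k) \<in> K" using K yK by (simp add: subspace_add subspace_scale)
    hence "d \<le> (norm (x - (1/2) *\<^sub>R (y m + y k)))\<^sup>2" by (rule d_le)
    moreover have "(norm (y m - y k))\<^sup>2 = 2 * (norm (x - y m))\<^sup>2 + 2 * (norm (x - y k))\<^sup>2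
        - 4 * (norm (x - (1/2) *\<^sub>R (y m + y k)))\<^sup>2"
      unfolding power2_norm_eq_inner
      by (simp add: inner_diff_left inner_diff_right inner_add_left inner_add_right inner_commute algebra_simps)
    ultimately show ?thesis using y[of m] y[of k] by linarith
  qed
  have "Cauchy y"
  proof (rule metric_CauchyI)
    fix e :: real assume "e > 0"
    hence "0 < e\<^sup>2 / 4" by simp
    then obtain N where N: "inverse (real (Suc N)) < e\<^sup>2 / 4" using reals_Archimedean by blast
    show "\<exists>M. \<forall>m\<ge>M. \<forall>n\<ge>M. dist (y m) (y n) < e"
    proof (intro exI allI impI)
      fix m n assume mn: "m \<ge> N" "n \<ge> N"
      have "inverse (real (Suc m)) \<le> inverse (real (Suc N))" "inverse (real (Suc n)) \<le> inverse (real (Suc N))"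
        using mn by (auto intro!: le_imp_inverse_le)
      hence "(norm (y m - y n))\<^sup>2 < e\<^sup>2" using par[of m n] N by linarith
      thus "dist (y m) (y n) < e" using \<open>e > 0\<close>
        by (simp add: dist_norm power2_less_imp_less)
    qed
  qed
  then obtain p where p: "y \<longlonglongrightarrow> p" using Cauchy_convergent convergent_def by blast
  have pK: "p \<in> K" using K(2) yK p closed_sequentially by blast
  have "(\<lambda>k. (norm (x - y k))\<^sup>2) \<longlonglongrightarrow> (norm (x - p))\<^sup>2" by (intro tendsto_intros p)
  moreover have "(\<lambda>k. d + inverse (real (Suc k))) \<longlonglongrightarrow> d + 0"
    by (intro tendsto_intros LIMSEQ_inverse_real_of_nat)
  ultimately have "(norm (x - p))\<^sup>2 \<le> d + 0"
    by (rule LIMSEQ_le) (use y less_imp_le in blast)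
  hence pd: "(norm (x - p))\<^sup>2 \<le> d" by simp
  have "inner (x - p) z = 0" if z: "z \<in> K" for z
  proof (rule quadratic_nonneg_imp_zero)
    fix t :: real
    have "p + t *\<^sub>R z \<in> K" using pK z K by (simp add: subspace_add subspace_scale)
    moreover have "x - (p + t *\<^sub>R z) = (x - p) - t *\<^sub>R z" by simp
    ultimately have "(norm (x - p))\<^sup>2 \<le> (norm ((x - p) - t *\<^sub>R z))\<^sup>2"
      using d_le pd by (metis order_trans)
    thus "0 \<le> t\<^sup>2 * (norm z)\<^sup>2 - 2 * t * inner (x - p) z"
      unfolding norm_diff_sq[of "x - p"] by (simp add: power_mult_distrib)
  qed
  thus ?thesis using pK by blast
qed

definition hproj :: "'a::chilbert set \<Rightarrow> 'a \<Rightarrow> 'a" where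
  "hproj K x = (SOME p. p \<in> K \<and> (\<forall>y\<in>K. inner (x - p) y = 0))"

context
  fixes K :: "'a::chilbert set"
  assumes K: "subspace K" "closed K"
begin

lemma hproj_spec: "hproj K x \<in> K \<and> (\<forall>y\<in>K. inner (x - hproj K x) y = 0)"
  unfolding hproj_def
  by (rule someI_ex) (use orthogonal_projection_exists[OF K] in blast)

lemma hproj_in: "hproj K x \<in> K"
  using hproj_spec by blast

lemma hproj_orth: "y \<in> K \<Longrightarrow> inner (x - hproj K x) y = 0"
  using hproj_spec by blast

lemma hproj_unique:
  assumes "p \<in> K" "\<And>y. y \<in> K \<Longrightarrow> inner (x - p) y = 0"
  shows "hproj K x = p"
proof -
  let ?u = "hproj K x - p"
  have u: "?u \<in> K" using assms(1) hproj_in K by (simp add: subspace_diff)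
  have "inner ?u ?u = inner (x - p) ?u - inner (x - hproj K x) ?u"
    by (simp add: inner_diff_left)
  also have "\<dots> = 0" using assms(2)[OF u] hproj_orth[OF u] by simp
  finally show ?thesis by simp
qed

lemma hproj_add: "hproj K (x + y) = hproj K x + hproj K y"
  by (rule hproj_unique)
     (use K hproj_in hproj_orth in \<open>auto simp: subspace_add add_diff_add inner_add_left\<close>)

lemma hproj_scaleR: "hproj K (r *\<^sub>R x) = r *\<^sub>R hproj K x"
  by (rule hproj_unique)
     (use K hproj_in hproj_orth in \<open>auto simp: subspace_scale simp flip: scaleR_diff_right\<close>)

lemma hproj_cJ:
  assumes "\<And>x. x \<in> K \<Longrightarrow> cJ x \<in> K"
  shows "hproj K (cJ x) = cJ (hproj K x)"
  by (rule hproj_unique)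
     (use assms hproj_in hproj_orth in \<open>auto simp: inner_cJ_left simp flip: cJ_diff\<close>)

lemma norm_hproj_diff_le: "norm (x - hproj K x) \<le> norm x"
proof -
  have "inner (x - hproj K x) (x - hproj K x) = inner (x - hproj K x) x"
    using hproj_orth[OF hproj_in, of x x] by (simp add: inner_diff_right)
  also have "\<dots> \<le> norm (x - hproj K x) * norm x" by (rule norm_cauchy_schwarz)
  finally have "norm (x - hproj K x) * norm (x - hproj K x) \<le> norm (x - hproj K x) * norm x"
    by (simp add: power2_norm_eq_inner[symmetric] power2_eq_square)
  thus ?thesis by (metis mult_le_cancel_left_pos norm_ge_zero order_le_less)
qed

end

text \<open>The residue of a vector of \<open>B\<close> after projection onto \<open>A\<close> stays
  in \<open>B\<close> and is orthogonal to \<open>A\<close>. Density of the range of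
  \<open>T\<close> in \<open>W\<close>, of the finitely supported elements and of the range of
  \<open>J\<close> in \<open>N\<close> is proved in this form.\<close>

lemma closed_subspace_eq_if_orth_zero:
  fixes A B :: "'a::chilbert set"
  assumes A: "subspace A" "closed A" and B: "subspace B" and "A \<subseteq> B"
    and orth: "\<And>y. y \<in> B \<Longrightarrow> (\<And>x. x \<in> A \<Longrightarrow> inner y x = 0) \<Longrightarrow> y = 0"
  shows "A = B"
proof
  show "B \<subseteq> A"
  proof
    fix y assume "y \<in> B"
    have "y - hproj A y = 0"
      using \<open>y \<in> B\<close> hproj_in[OF A] \<open>A \<subseteq> B\<close>
      by (intro orth) (auto simp: hproj_orth[OF A] intro: subspace_diff[OF B])
    thus "y \<in> A" using hproj_in[OF A, of y] by simp
  qed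
qed fact

lemma inner_zero_closure_span:
  fixes S :: "'a::real_inner set"
  assumes "\<And>x. x \<in> S \<Longrightarrow> inner y x = 0" and "x \<in> closure (span S)"
  shows "inner y x = 0"
proof -
  have "span S \<subseteq> {x. inner y x = 0}"
    using assms(1) by (intro span_minimal) (auto simp: subspace_hyperplane)
  hence "closure (span S) \<subseteq> {x. inner y x = 0}"
    by (intro closure_minimal closed_hyperplane)
  thus ?thesis using assms(2) by blast
qed

text \<open>Any vector off the kernel has a nonzero component \<open>u\<close> orthogonal to it.
  Every \<open>x\<close> differs from a multiple of \<open>u\<close> by a kernel element, so pairing
  with \<open>u\<close> recovers \<open>f x\<close> up to a constant.\<close>

lemma riesz_representation:
  fixes f :: "'a::chilbert \<Rightarrow> real"
  assumes "bounded_linear f"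
  shows "\<exists>a. \<forall>x. f x = inner a x"
proof (cases "\<forall>x. f x = 0")
  case True
  thus ?thesis by (intro exI[of _ 0]) simp
next
  case False
  then obtain z where z: "f z \<noteq> 0" by blast
  interpret f: bounded_linear f by fact
  define K where "K = {x. f x = 0}"
  have K: "subspace K" "closed K"
    unfolding K_def
    by (auto simp: subspace_def f.add f.scaleR f.zero intro!: closed_Collect_eq f.continuous_on continuous_intros)
  define u where "u = z - hproj K z"
  have fu: "f u \<noteq> 0" using z hproj_in[OF K, of z] by (auto simp: u_def f.diff K_def)
  hence u0: "inner u u \<noteq> 0" by (auto simp: f.zero)
  have "f x = inner ((f u / inner u u) *\<^sub>R u) x" for x
  proof -
    have "x - (f x / f u) *\<^sub>R u \<in> K" using fu by (simp add: K_def f.diff f.scaleR)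
    hence "inner u (x - (f x / f u) *\<^sub>R u) = 0" unfolding u_def by (rule hproj_orth[OF K])
    thus ?thesis using fu u0 by (simp add: inner_diff_right field_simps)
  qed
  thus ?thesis by blast
qed

text \<open>\<open>A\<close> is the adjoint of \<open>T\<close> composed with \<open>T\<close>,
  obtained by representing \<open>inner (T x) (T y)\<close> as a functional of
  \<open>y\<close>.\<close>

lemma gram_operator_exists:
  fixes T :: "'a::chilbert \<Rightarrow> 'b::chilbert"
  assumes "bounded_linear T"
  shows "\<exists>A. \<forall>x y. inner (A x) y = inner (T x) (T y)"
proof -
  interpret T: bounded_linear T by fact
  have "\<exists>a. \<forall>y. inner (T x) (T y) = inner a y" for x
    by (intro riesz_representation bounded_linear_compose[OF bounded_linear_inner_right] T.bounded_linear_axioms)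
  thus ?thesis by metis
qed

section \<open>Isometries: closed images and extension to the closure\<close>

lemma lin_on_isometric_continuous:
  assumes T: "lin_on K T" and K: "subspace K" and iso: "\<And>x. x \<in> K \<Longrightarrow> norm (T x) = norm x"
  shows "continuous_on K T"
proof -
  have "dist (T x) (T y) = dist x y" if "x \<in> K" "y \<in> K" for x y
    using lin_on_diff[OF T K that] iso[of "x - y"] subspace_diff[OF K that] by (simp add: dist_norm)
  thus ?thesis unfolding continuous_on_iff by metis
qed

lemma lin_on_isometric_closed_image:
  fixes T :: "'a::chilbert \<Rightarrow> 'b::chilbert"
  assumes T: "lin_on K T" and K: "subspace K" "closed K"
    and iso: "\<And>x. x \<in> K \<Longrightarrow> norm (T x) = norm x"
  shows "closed (T ` K)"
  unfolding closed_sequential_limits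
proof (intro allI impI, elim conjE)
  fix s l assume s: "\<forall>k. s k \<in> T ` K" "s \<longlonglongrightarrow> l"
  hence "\<forall>k. \<exists>x. x \<in> K \<and> s k = T x" by blast
  then obtain x where x: "\<And>k. x k \<in> K" "\<And>k. s k = T (x k)" by metis
  have "dist (x i) (x j) = dist (s i) (s j)" for i j
    using lin_on_diff[OF T K(1) x(1) x(1), of i j] iso[of "x i - x j"] x subspace_diff[OF K(1)]
    by (simp add: dist_norm)
  hence "Cauchy x" using LIMSEQ_imp_Cauchy[OF s(2)] by (simp add: Cauchy_def)
  then obtain p where p: "x \<longlonglongrightarrow> p" using Cauchy_convergent convergent_def by blast
  have pK: "p \<in> K" using K(2) x(1) p closed_sequentially by blast
  have "(\<lambda>k. T (x k)) \<longlonglongrightarrow> T p"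
    by (rule continuous_on_tendsto_compose[OF lin_on_isometric_continuous[OF T K(1) iso] p pK])
       (use x in auto)
  moreover have "s = (\<lambda>k. T (x k))" using x by auto
  ultimately have "l = T p" using s(2) LIMSEQ_unique by blast
  thus "l \<in> T ` K" using pK by blast
qed

lemma lin_on_span_image:
  assumes T: "lin_on K T" and K: "subspace K" and S: "S \<subseteq> K"
  shows "T ` span S = span (T ` S)"
proof
  have sK: "span S \<subseteq> K" using K S by (simp add: span_minimal)
  have "span S \<subseteq> {x\<in>K. T x \<in> span (T ` S)}"
    using K S lin_onD(1,2)[OF T]
    by (intro span_minimal)
       (auto simp: subspace_def span_base span_add span_scale lin_on_0[OF T] span_zero)
  thus "T ` span S \<subseteq> span (T ` S)" by blast
  have "subspace (T ` span S)"
    unfolding subspace_def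
  proof (intro conjI ballI allI)
    show "0 \<in> T ` span S"
      using lin_on_0[OF T] K by (metis image_eqI span_zero subspace_0)
  next
    fix x y assume "x \<in> T ` span S" "y \<in> T ` span S"
    then obtain a b where "a \<in> span S" "b \<in> span S" "x = T a" "y = T b" by blast
    thus "x + y \<in> T ` span S"
      using lin_onD(1)[OF T, of a b] sK by (metis image_eqI span_add subsetD)
  next
    fix c x assume "x \<in> T ` span S"
    then obtain a where "a \<in> span S" "x = T a" by blast
    thus "c *\<^sub>R x \<in> T ` span S"
      using lin_onD(2)[OF T, of a c] sK by (metis image_eqI span_scale subsetD)
  qed
  thus "span (T ` S) \<subseteq> T ` span S"
    by (intro span_minimal image_mono) (auto simp: span_superset)
qed

text \<open>Continuity gives one inclusion; the other holds because an isometry maps closed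
  subspaces to closed ones.\<close>

lemma lin_on_isometric_closure_span:
  fixes T :: "'a::chilbert \<Rightarrow> 'b::chilbert"
  assumes T: "lin_on K T" and K: "subspace K" "closed K"
    and iso: "\<And>x. x \<in> K \<Longrightarrow> norm (T x) = norm x" and S: "S \<subseteq> K"
  shows "T ` closure (span S) = closure (span (T ` S))"
proof
  have cK: "closure (span S) \<subseteq> K" using K S by (simp add: closure_minimal span_minimal)
  have "continuous_on (closure (span S)) T"
    using lin_on_isometric_continuous[OF T K(1) iso] cK by (rule continuous_on_subset)
  thus "T ` closure (span S) \<subseteq> closure (span (T ` S))"
    using lin_on_span_image[OF T K(1) S] closure_subset
    by (intro image_closure_subset) auto
  have "closed (T ` closure (span S))"
    using lin_on_isometric_closed_image[OF lin_on_subset[OF T cK]] cK iso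
    by (auto simp: subspace_closure)
  moreover have "span (T ` S) \<subseteq> T ` closure (span S)"
    using lin_on_span_image[OF T K(1) S] closure_subset by blast
  ultimately show "closure (span (T ` S)) \<subseteq> T ` closure (span S)" by (simp add: closure_minimal)
qed

text \<open>An isometry is uniformly continuous, so it extends, and its algebraic properties survive
  limits along sequences. It is used twice: for the partial isometry of the polar decomposition and
  for the inner operator, which is first known only on finite sums.\<close>

lemma lin_on_isometric_extension:
  fixes T :: "'a::chilbert \<Rightarrow> 'b::chilbert"
  assumes D: "subspace D" "\<And>x. x \<in> D \<Longrightarrow> cJ x \<in> D" and T: "lin_on D T"
    and iso: "\<And>x. x \<in> D \<Longrightarrow> norm (T x) = norm x"
  obtains V where "lin_on (closure D) V" "\<And>x. x \<in> closure D \<Longrightarrow> norm (V x) = norm x"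
    "V ` closure D = closure (T ` D)" "\<And>x. x \<in> D \<Longrightarrow> V x = T x"
proof -
  have dist: "dist (T x) (T y) = dist x y" if "x \<in> D" "y \<in> D" for x y
    using lin_on_diff[OF T D(1) that] iso[of "x - y"] subspace_diff[OF D(1) that] by (simp add: dist_norm)
  have "uniformly_continuous_on D T"
    unfolding uniformly_continuous_on_def using dist by metis
  then obtain V where V: "uniformly_continuous_on (closure D) V" and VT: "\<And>x. x \<in> D \<Longrightarrow> T x = V x"
    using uniformly_continuous_on_extension_on_closure by metis
  have cV: "continuous_on (closure D) V" using V by (rule uniformly_continuous_imp_continuous)
  have Vlim: "(\<lambda>k. T (s k)) \<longlonglongrightarrow> V x" if "\<And>k. s k \<in> D" "s \<longlonglongrightarrow> x" for s x
  proof -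
    have x: "x \<in> closure D" using that closure_sequential by blast
    have "(\<lambda>k. V (s k)) \<longlonglongrightarrow> V x"
      using continuous_on_tendsto_compose[OF cV that(2) x] that(1) closure_subset by (auto intro: always_eventually)
    thus ?thesis using that(1) VT by simp
  qed
  have cD: "subspace (closure D)" by (rule subspace_closure[OF D(1)])
  have seq: "\<exists>s. (\<forall>k. s k \<in> D) \<and> s \<longlonglongrightarrow> x" if "x \<in> closure D" for x
    using that closure_sequential by blast
  have norm: "norm (V x) = norm x" if x: "x \<in> closure D" for x
  proof -
    obtain s where s: "\<And>k. s k \<in> D" "s \<longlonglongrightarrow> x" using seq[OF x] by blast
    have "(\<lambda>k. norm (T (s k))) \<longlonglongrightarrow> norm (V x)" by (intro tendsto_norm Vlim s)
    moreover have "(\<lambda>k. norm (T (s k))) \<longlonglongrightarrow> norm x" using tendsto_norm[OF s(2)] iso s(1) by simp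
    ultimately show ?thesis by (rule LIMSEQ_unique)
  qed
  have lin: "lin_on (closure D) V"
    unfolding lin_on_def
  proof (intro conjI ballI allI)
    fix x y assume xy: "x \<in> closure D" "y \<in> closure D"
    obtain s where s: "\<And>k. s k \<in> D" "s \<longlonglongrightarrow> x" using seq[OF xy(1)] by blast
    obtain t where t: "\<And>k. t k \<in> D" "t \<longlonglongrightarrow> y" using seq[OF xy(2)] by blast
    have "(\<lambda>k. T (s k + t k)) \<longlonglongrightarrow> V (x + y)"
      using s t D(1) by (intro Vlim tendsto_add) (auto simp: subspace_add)
    moreover have "(\<lambda>k. T (s k + t k)) \<longlonglongrightarrow> V x + V y"
      using tendsto_add[OF Vlim[OF s] Vlim[OF t]] lin_onD(1)[OF T] s t by simp
    ultimately show "V (x + y) = V x + V y" by (rule LIMSEQ_unique)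
  next
    fix x r assume x: "x \<in> closure D"
    obtain s where s: "\<And>k. s k \<in> D" "s \<longlonglongrightarrow> x" using seq[OF x] by blast
    have "(\<lambda>k. T (r *\<^sub>R s k)) \<longlonglongrightarrow> V (r *\<^sub>R x)"
      using s D(1) by (intro Vlim tendsto_scaleR) (auto simp: subspace_scale)
    moreover have "(\<lambda>k. T (r *\<^sub>R s k)) \<longlonglongrightarrow> r *\<^sub>R V x"
      using tendsto_scaleR[OF tendsto_const Vlim[OF s], of r] lin_onD(2)[OF T] s by simp
    ultimately show "V (r *\<^sub>R x) = r *\<^sub>R V x" by (rule LIMSEQ_unique)
  next
    fix x assume x: "x \<in> closure D"
    obtain s where s: "\<And>k. s k \<in> D" "s \<longlonglongrightarrow> x" using seq[OF x] by blast
    have "(\<lambda>k. T (cJ (s k))) \<longlonglongrightarrow> V (cJ x)"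
      using s D(2) by (intro Vlim bounded_linear.tendsto[OF bounded_linear_cJ]) auto
    moreover have "(\<lambda>k. T (cJ (s k))) \<longlonglongrightarrow> cJ (V x)"
      using bounded_linear.tendsto[OF bounded_linear_cJ Vlim[OF s]] lin_onD(3)[OF T] s by simp
    ultimately show "V (cJ x) = cJ (V x)" by (rule LIMSEQ_unique)
  qed
  have img: "V ` closure D = closure (T ` D)"
  proof
    show "V ` closure D \<subseteq> closure (T ` D)"
      using cV closure_subset VT by (intro image_closure_subset) fastforce+
    have "closed (V ` closure D)"
      by (rule lin_on_isometric_closed_image[OF lin cD closed_closure norm])
    moreover have "T ` D \<subseteq> V ` closure D" using VT closure_subset by fastforce
    ultimately show "closure (T ` D) \<subseteq> V ` closure D" by (simp add: closure_minimal)
  qed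
  show ?thesis by (rule that[OF lin norm img]) (simp_all add: VT)
qed

section \<open>Square roots and polar decomposition\<close>

text \<open>The Taylor coefficients of (1 - t)^(1/2) at 0.\<close>

definition sqrt_coeff :: "nat \<Rightarrow> real" where
  "sqrt_coeff k = (-1) ^ k * ((1/2) gchoose k)"

text \<open>The square of the series is 1 - t: Vandermonde's identity with 1/2 + 1/2 = 1 turns the
  convolution into the signed binomial coefficients of 1.\<close>

lemma sqrt_coeff_convolution:
  "(\<Sum>j\<le>l. sqrt_coeff j * sqrt_coeff (l - j)) = (if l = 0 then 1 else if l = 1 then -1 else 0)"
proof -
  have "(\<Sum>j\<le>l. sqrt_coeff j * sqrt_coeff (l - j))
      = (\<Sum>j\<in>{0..l}. (-1) ^ l * (((1/2) gchoose j) * ((1/2) gchoose (l - j))))"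
    by (rule sum.cong) (auto simp: sqrt_coeff_def atMost_atLeast0 simp flip: power_add)
  also have "\<dots> = (-1) ^ l * ((1/2 + 1/2 :: real) gchoose l)"
    by (simp only: sum_distrib_left[symmetric] gbinomial_Vandermonde)
  also have "(1/2 + 1/2 :: real) gchoose l = of_nat (1 choose l)"
    by (simp add: binomial_gbinomial)
  finally show ?thesis by (auto simp: binomial_eq_0)
qed

lemma sqrt_coeff_0: "sqrt_coeff 0 = 1"
  by (simp add: sqrt_coeff_def)

text \<open>From index \<open>Suc k\<close> to the next the coefficient is multiplied by the
  positive ratio (k + 1/2) / (k + 2), so the sign of the coefficient -1/2 at index 1
  persists.\<close>

lemma sqrt_coeff_Suc_nonpos: "sqrt_coeff (Suc k) \<le> 0"
proof (induction k)
  case 0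
  show ?case by (simp add: sqrt_coeff_def)
next
  case (Suc k)
  have "real (Suc (Suc k)) * sqrt_coeff (Suc (Suc k)) = (real (Suc k) - 1/2) * sqrt_coeff (Suc k)"
  proof -
    have "real (Suc (Suc k)) * ((1/2) gchoose Suc (Suc k)) = (1/2 - real (Suc k)) * ((1/2 :: real) gchoose Suc k)"
      using gbinomial_mult_1[of "1/2::real" "Suc k"] by (simp only: left_diff_distrib)
    hence "(-1) ^ k * (real (Suc (Suc k)) * ((1/2) gchoose Suc (Suc k)))
        = (-1) ^ k * ((1/2 - real (Suc k)) * ((1/2 :: real) gchoose Suc k))" by simp
    thus ?thesis unfolding sqrt_coeff_def by (simp add: algebra_simps)
  qed
  also have "\<dots> \<le> 0" using Suc.IH by (intro mult_nonneg_nonpos) auto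
  finally show ?case by (simp add: mult_le_0_iff)
qed

text \<open>Partial sums are the coefficients of (1 - t)^(1/2) / (1 - t) = (1 - t)^(-1/2), and these
  are nonnegative by their own recursion.\<close>

lemma sum_sqrt_coeff_nonneg: "0 \<le> (\<Sum>k\<le>m. sqrt_coeff k)"
proof -
  have "(\<Sum>k\<le>m. sqrt_coeff k) = (-1) ^ m * ((-1/2 :: real) gchoose m)"
    using gbinomial_sum_lower_neg[of "1/2 :: real" m] by (simp add: sqrt_coeff_def mult.commute)
  moreover have "0 \<le> (-1) ^ m * ((-1/2 :: real) gchoose m)"
  proof (induction m)
    case (Suc k)
    have "real (Suc k) * ((-1) ^ Suc k * ((-1/2 :: real) gchoose Suc k))
        = (real k + 1/2) * ((-1) ^ k * ((-1/2) gchoose k))"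
    proof -
      have "real (Suc k) * ((-1/2) gchoose Suc k) = (-1/2 - real k) * ((-1/2 :: real) gchoose k)"
        using gbinomial_mult_1[of "-1/2::real" k] by (simp only: left_diff_distrib)
      hence "(-1) ^ k * (real (Suc k) * ((-1/2) gchoose Suc k))
          = (-1) ^ k * ((-1/2 - real k) * ((-1/2 :: real) gchoose k))" by simp
      thus ?thesis by (simp add: algebra_simps)
    qed
    also have "\<dots> \<ge> 0" using Suc.IH by (intro mult_nonneg_nonneg[of "real k + 1/2"]) auto
    finally show ?case by (metis mult_pos_neg not_le of_nat_0_less_iff zero_less_Suc)
  qed simp
  ultimately show ?thesis by simp
qed

lemma sqrt_coeff_abs_summable: "(\<lambda>k. \<bar>sqrt_coeff k\<bar>) summable_on UNIV"
proof -
  \<comment> \<open>Only the constant term 1 is positive, so the absolute values sum to 2 minus a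
    partial sum of the coefficients, which is nonnegative.\<close>
  have "(\<Sum>k<m. \<bar>sqrt_coeff k\<bar>) \<le> 2" for m
  proof (cases m)
    case (Suc i)
    have "\<bar>sqrt_coeff k\<bar> = (if k = 0 then 2 else 0) - sqrt_coeff k" for k
      using sqrt_coeff_Suc_nonpos[of "k - 1"] by (cases k) (auto simp: sqrt_coeff_0)
    hence "(\<Sum>k<m. \<bar>sqrt_coeff k\<bar>) = 2 - (\<Sum>k\<le>i. sqrt_coeff k)"
      unfolding Suc lessThan_Suc_atMost by (simp add: sum_subtractf)
    thus ?thesis using sum_sqrt_coeff_nonneg[of i] by simp
  qed simp
  hence "summable (\<lambda>k. \<bar>sqrt_coeff k\<bar>)"
    by (intro summableI_nonneg_bounded) auto
  thus ?thesis by (simp add: norm_summable_imp_summable_on)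
qed

lemma infsum_bounded_linear:
  assumes "bounded_linear h" "f summable_on A"
  shows "infsum (\<lambda>x. h (f x)) A = h (infsum f A)"
  by (rule infsumI has_sum_bounded_linear assms has_sum_infsum)+

definition sqrt_series :: "('a::chilbert \<Rightarrow> 'a) \<Rightarrow> 'a \<Rightarrow> 'a" where
  "sqrt_series X x = (\<Sum>\<^sub>\<infinity>k. sqrt_coeff k *\<^sub>R (X ^^ k) x)"

context
  fixes X :: "'a::chilbert \<Rightarrow> 'a"
  assumes contr: "\<And>x. norm (X x) \<le> norm x"
begin

lemma norm_funpow_le: "norm ((X ^^ k) x) \<le> norm x"
  by (induction k) (auto intro: order_trans[OF contr])

lemma sqrt_series_abs_summable: "(\<lambda>k. norm (sqrt_coeff k *\<^sub>R (X ^^ k) x)) summable_on UNIV"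
proof (rule summable_on_comparison_test)
  show "(\<lambda>k. \<bar>sqrt_coeff k\<bar> * norm x) summable_on UNIV"
    by (intro summable_on_cmult_left sqrt_coeff_abs_summable)
qed (auto intro: mult_left_mono norm_funpow_le)

lemma sqrt_series_summable: "(\<lambda>k. sqrt_coeff k *\<^sub>R (X ^^ k) x) summable_on UNIV"
  by (rule abs_summable_summable[OF sqrt_series_abs_summable])

text \<open>The Cauchy product of the series with itself collapses to \<open>1 - X\<close>.\<close>

lemma norm_sqrt_series:
  assumes sym: "\<And>x y. inner (X x) y = inner x (X y)"
  shows "(norm (sqrt_series X x))\<^sup>2 = inner x x - inner (X x) x"
proof -
  define f where "f k = sqrt_coeff k *\<^sub>R (X ^^ k) x" for k
  define m where "m l = inner ((X ^^ l) x) x" for l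
  have sym_pow: "inner ((X ^^ j) y) z = inner y ((X ^^ j) z)" for j y z
    by (induction j arbitrary: y) (simp_all add: funpow_Suc_right sym del: funpow.simps(2), simp add: funpow_swap1)
  have f_inner: "inner (f j) (f k) = sqrt_coeff j * sqrt_coeff k * m (j + k)" for j k
    by (simp add: f_def m_def sym_pow[of j] funpow_add inner_commute[of x] mult.assoc)
  have sf: "f summable_on UNIV" unfolding f_def by (rule sqrt_series_summable)
  define F where "F = (\<lambda>(j,k). inner (f j) (f k))"
  have nf: "(\<lambda>k. norm (f k)) summable_on UNIV" unfolding f_def by (rule sqrt_series_abs_summable)
  have "(\<lambda>p. norm (f (fst p)) * norm (f (snd p))) summable_on UNIV \<times> UNIV"
    by (rule summable_on_SigmaI[where g="\<lambda>j. norm (f j) * infsum (\<lambda>k. norm (f k)) UNIV"])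
       (auto intro!: has_sum_cmult_right has_sum_infsum summable_on_cmult_left nf)
  hence "(\<lambda>p. norm (F p)) summable_on UNIV \<times> UNIV"
    by (rule summable_on_comparison_test)
       (auto simp: F_def Cauchy_Schwarz_ineq2)
  hence F: "F summable_on UNIV \<times> UNIV" by (rule abs_summable_summable)
  \<comment> \<open>The double sum is rearranged by the total degree \<open>l = j + k\<close>, which
    absolute summability of \<open>F\<close> permits. By symmetry of \<open>X\<close> a term
    involves its powers only through \<open>m l\<close>, so the inner sum becomes the convolution of
    the coefficients.\<close>
  define G where "G = (\<lambda>(l,j). sqrt_coeff j * sqrt_coeff (l - j) * m l)"
  let ?T = "Sigma UNIV (\<lambda>l::nat. {..l})"
  have FG: "infsum F (UNIV \<times> UNIV) = infsum G ?T"
    by (rule infsum_reindex_bij_witness[of _ "\<lambda>(l,j). (j, l - j)" "\<lambda>(j,k). (j + k, j)"])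
       (auto simp: F_def G_def f_inner)
  have G: "G summable_on ?T"
    using F by (subst (asm) summable_on_reindex_bij_witness[of _ "\<lambda>(l,j). (j, l - j)" "\<lambda>(j,k). (j + k, j)" ?T G])
       (auto simp: F_def G_def f_inner)
  have S: "sqrt_series X x = infsum f UNIV" by (simp add: sqrt_series_def f_def[abs_def])
  have "inner (infsum f UNIV) (infsum f UNIV) = (\<Sum>\<^sub>\<infinity>j. inner (f j) (infsum f UNIV))"
    using infsum_bounded_linear[OF bounded_linear_inner_left sf] by simp
  also have "\<dots> = (\<Sum>\<^sub>\<infinity>j. \<Sum>\<^sub>\<infinity>k. F (j, k))"
    using infsum_bounded_linear[OF bounded_linear_inner_right sf] by (simp add: F_def)
  also have "\<dots> = infsum G ?T"
    using infsum_Sigma_banach[OF F] FG by simp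
  also have "\<dots> = (\<Sum>\<^sub>\<infinity>l. \<Sum>\<^sub>\<infinity>j\<in>{..l}. G (l, j))"
    using infsum_Sigma_banach[OF G] by simp
  also have "\<dots> = (\<Sum>\<^sub>\<infinity>l. (if l = 0 then 1 else if l = 1 then -1 else 0) * m l)"
    by (simp only: infsum_finite finite_atMost G_def prod.case sqrt_coeff_convolution flip: sum_distrib_right)
  also have "\<dots> = (\<Sum>\<^sub>\<infinity>l\<in>{0,1}. (if l = 0 then 1 else if l = 1 then -1 else 0) * m l)"
    by (rule infsum_cong_neutral) auto
  also have "\<dots> = m 0 - m 1" by simp
  finally show ?thesis by (simp add: S power2_norm_eq_inner m_def)
qed

lemma sqrt_series_lin_on:
  assumes X: "lin_on UNIV X"
  shows "lin_on UNIV (sqrt_series X)"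
proof -
  have pw: "(X ^^ k) (x + y) = (X ^^ k) x + (X ^^ k) y" "(X ^^ k) (r *\<^sub>R x) = r *\<^sub>R (X ^^ k) x"
    "(X ^^ k) (cJ x) = cJ ((X ^^ k) x)" for k x y r
    by (induction k) (auto simp: lin_onD[OF X])
  have "sqrt_series X (x + y) = sqrt_series X x + sqrt_series X y" for x y
    unfolding sqrt_series_def
    by (subst infsum_add[symmetric]) (auto simp: sqrt_series_summable pw scaleR_add_right)
  moreover have "sqrt_series X (r *\<^sub>R x) = r *\<^sub>R sqrt_series X x" for r x
    using infsum_bounded_linear[OF bounded_linear_scaleR_right[of r] sqrt_series_summable[of x]]
    by (simp add: sqrt_series_def pw mult.commute)
  moreover have "sqrt_series X (cJ x) = cJ (sqrt_series X x)" for x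
    using infsum_bounded_linear[OF bounded_linear_cJ sqrt_series_summable[of x]]
    by (simp add: sqrt_series_def pw cJ_scaleR)
  ultimately show ?thesis by (simp add: lin_on_def)
qed

end

text \<open>\<open>S\<close> is the positive square root of \<open>T\<^sup>* T\<close>, obtained after rescaling from the binomial series of
  \<open>(1 - X)\<^bsup>1/2\<^esup>\<close> with \<open>X = 1 - T\<^sup>* T\<close>, which converges absolutely also for \<open>\<parallel>X\<parallel> = 1\<close>.\<close>

lemma absolute_value_exists:
  fixes T :: "'a::chilbert \<Rightarrow> 'b::chilbert"
  assumes T: "lin_on UNIV T" and bdd: "\<And>x. norm (T x) \<le> C * norm x"
  shows "\<exists>S :: 'a \<Rightarrow> 'a. lin_on UNIV S \<and> (\<forall>x. norm (S x) = norm (T x))"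
proof -
  \<comment> \<open>The maximum with 1 guards against a bound that is zero or negative, so that
    division by \<open>c\<close> is possible.\<close>
  define c where "c = max C 1"
  have c: "c > 0" by (simp add: c_def)
  define T1 where "T1 x = (1/c) *\<^sub>R T x" for x
  have T1_lin: "lin_on UNIV T1"
    using T by (simp add: lin_on_def T1_def scaleR_add_right cJ_scaleR)
  have T1_le: "norm (T1 x) \<le> norm x" for x
  proof -
    have "norm (T x) \<le> c * norm x"
      using bdd[of x] mult_right_mono[of C c "norm x"] by (simp add: c_def)
    thus ?thesis using c by (simp add: T1_def field_simps)
  qed
  have "bounded_linear T1"
    using T1_le by (intro bounded_linear_intro[where K=1]) (auto simp: lin_onD[OF T1_lin])
  then obtain A where A: "\<And>x y. inner (A x) y = inner (T1 x) (T1 y)"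
    using gram_operator_exists by blast
  have eqI: "u = v" if "\<And>y. inner u y = inner v y" for u v :: 'a
    using that[of "u - v"] by (metis inner_diff_left inner_eq_zero_iff right_minus_eq)
  have A_lin: "lin_on UNIV A"
    unfolding lin_on_def
    by (auto intro!: eqI simp: A lin_onD[OF T1_lin] inner_add_left inner_cJ_left)
  define X where "X x = x - A x" for x
  have X_lin: "lin_on UNIV X"
    by (simp add: lin_on_def X_def lin_onD[OF A_lin] scaleR_diff_right cJ_diff)
  have X_sym: "inner (X x) y = inner x (X y)" for x y
    by (simp add: X_def inner_diff_left inner_diff_right A inner_commute[of x "A y"])
       (simp add: inner_commute)
  \<comment> \<open>In the expansion of the squared norm of \<open>x - A x\<close> the cross term
    removes twice \<open>(norm (T1 x))\<^sup>2\<close>, while the square of \<open>A x\<close> adds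
    that amount at most once.\<close>
  have X_le: "norm (X x) \<le> norm x" for x
  proof -
    have "(norm (A x))\<^sup>2 = inner (T1 x) (T1 (A x))" by (simp add: power2_norm_eq_inner A)
    also have "\<dots> \<le> norm (T1 x) * norm (T1 (A x))" by (rule norm_cauchy_schwarz)
    also have "\<dots> \<le> norm (T1 x) * norm (A x)" by (intro mult_left_mono T1_le) auto
    finally have "norm (A x) * norm (A x) \<le> norm (T1 x) * norm (A x)" by (simp add: power2_eq_square)
    hence "norm (A x) \<le> norm (T1 x)"
      by (metis mult_le_cancel_right_pos norm_ge_zero order_le_less)
    hence "(norm (A x))\<^sup>2 \<le> (norm (T1 x))\<^sup>2" by (intro power_mono) auto
    moreover have "inner x (A x) = (norm (T1 x))\<^sup>2"
      by (simp add: inner_commute[of x] A power2_norm_eq_inner)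
    ultimately have "(norm (X x))\<^sup>2 \<le> (norm x)\<^sup>2"
      unfolding X_def norm_diff_sq by (smt (verit) zero_le_power2)
    thus ?thesis by (rule power2_le_imp_le) simp
  qed
  have "(norm (sqrt_series X x))\<^sup>2 = (norm (T1 x))\<^sup>2" for x
    using norm_sqrt_series[OF X_le X_sym, of x] by (simp add: X_def[of x] inner_diff_left A power2_norm_eq_inner)
  hence norm: "norm (sqrt_series X x) = norm (T1 x)" for x
    by simp
  have "lin_on UNIV (\<lambda>x. c *\<^sub>R sqrt_series X x)"
    using sqrt_series_lin_on[OF X_le X_lin] by (simp add: lin_on_def scaleR_add_right cJ_scaleR)
  moreover have "norm (c *\<^sub>R sqrt_series X x) = norm (T x)" for x
    using c by (simp add: norm T1_def)
  ultimately show ?thesis by blast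
qed

text \<open>This is why the coefficient space of the inner factor can be found inside the domain of the symbol.\<close>

lemma closure_range_isometric:
  fixes T :: "'a::chilbert \<Rightarrow> 'b::chilbert"
  assumes T: "lin_on UNIV T" and bdd: "\<And>x. norm (T x) \<le> C * norm x"
  shows "\<exists>(K :: 'a set) V. csubspace K \<and> lin_on K V \<and> V ` K = closure (range T) \<and> (\<forall>x\<in>K. norm (V x) = norm x)"
proof -
  obtain S :: "'a \<Rightarrow> 'a" where S: "lin_on UNIV S" and ST: "\<And>x. norm (S x) = norm (T x)"
    using absolute_value_exists[OF T bdd] by blast
  \<comment> \<open>The isometric part of the polar decomposition, sending \<open>S x\<close> to
    \<open>T x\<close>. The choice of preimage does not matter, since equal norms give
    \<open>S\<close> and \<open>T\<close> the same kernel.\<close>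
  define V0 where "V0 y = T (SOME x. S x = y)" for y
  have V0: "V0 (S x) = T x" for x
  proof -
    define z where "z = (SOME z. S z = S x)"
    have "S z = S x" unfolding z_def by (rule someI) (rule refl)
    hence "S (z - x) = 0" using lin_on_diff[OF S] by simp
    hence "T (z - x) = 0" using ST[of "z - x"] by simp
    hence "T z = T x" using lin_on_diff[OF T, of z x] by simp
    thus ?thesis by (simp add: V0_def z_def)
  qed
  have D: "subspace (range S)" "\<And>x. x \<in> range S \<Longrightarrow> cJ x \<in> range S"
    unfolding subspace_def
    by (auto simp flip: lin_onD[OF S] intro: range_eqI[of _ S 0] simp: lin_on_0[OF S])
  have V0_lin: "lin_on (range S) V0"
    unfolding lin_on_def by (auto simp: V0 lin_onD[OF T] simp flip: lin_onD[OF S])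
  obtain V where V: "lin_on (closure (range S)) V" "\<And>x. x \<in> closure (range S) \<Longrightarrow> norm (V x) = norm x"
    "V ` closure (range S) = closure (V0 ` range S)"
    by (rule lin_on_isometric_extension[OF D V0_lin]) (auto simp: V0 ST)
  have "csubspace (closure (range S))"
    using csubspace_closure_span[of "range S"] D by (simp add: span_eq_iff[THEN iffD2])
  moreover have "V0 ` range S = range T" by (simp add: image_image V0)
  ultimately show ?thesis using V by metis
qed

section \<open>Square-summable families\<close>

definition sq_summable :: "('i \<Rightarrow> 'k::chilbert) \<Rightarrow> bool" where
  "sq_summable f \<longleftrightarrow> (\<lambda>i. (norm (f i))\<^sup>2) summable_on UNIV"

lemma sq_summable_bdd:
  assumes "\<And>F. finite F \<Longrightarrow> (\<Sum>i\<in>F. (norm (f i))\<^sup>2) \<le> C"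
  shows "sq_summable f" and "infsum (\<lambda>i. (norm (f i))\<^sup>2) UNIV \<le> C"
proof -
  show s: "sq_summable f"
    unfolding sq_summable_def
    by (rule nonneg_bdd_above_summable_on) (use assms in \<open>auto intro!: bdd_aboveI[of _ C]\<close>)
  show "infsum (\<lambda>i. (norm (f i))\<^sup>2) UNIV \<le> C"
    using s assms unfolding sq_summable_def by (intro infsum_le_finite_sums) auto
qed

lemma sq_summable_add: "sq_summable f \<Longrightarrow> sq_summable g \<Longrightarrow> sq_summable (\<lambda>i. f i + g i)"
  unfolding sq_summable_def
proof (rule summable_on_comparison_test)
  show "(\<lambda>i. 2 * (norm (f i))\<^sup>2 + 2 * (norm (g i))\<^sup>2) summable_on UNIV"
    if "(\<lambda>i. (norm (f i))\<^sup>2) summable_on UNIV" "(\<lambda>i. (norm (g i))\<^sup>2) summable_on UNIV"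
    using that by (intro summable_on_add summable_on_cmult_right)
  have "(norm (x + y))\<^sup>2 \<le> 2 * (norm x)\<^sup>2 + 2 * (norm y)\<^sup>2" for x y :: 'b
    using zero_le_power2[of "norm (x - y)"] unfolding norm_add_sq norm_diff_sq by linarith
  thus "(norm (f i + g i))\<^sup>2 \<le> 2 * (norm (f i))\<^sup>2 + 2 * (norm (g i))\<^sup>2" for i .
qed auto

lemma sq_summable_scaleR: "sq_summable f \<Longrightarrow> sq_summable (\<lambda>i. r *\<^sub>R f i)"
  unfolding sq_summable_def by (simp add: power_mult_distrib summable_on_cmult_right)

lemma sq_summable_uminus: "sq_summable f \<Longrightarrow> sq_summable (\<lambda>i. - f i)"
  unfolding sq_summable_def by simp

lemma sq_summable_cJ: "sq_summable f \<Longrightarrow> sq_summable (\<lambda>i. cJ (f i))"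
  unfolding sq_summable_def by simp

lemma sq_summable_diff: "sq_summable f \<Longrightarrow> sq_summable g \<Longrightarrow> sq_summable (\<lambda>i. f i - g i)"
  using sq_summable_add[OF _ sq_summable_uminus, of f g] by simp

lemma sq_summable_inner:
  assumes "sq_summable f" "sq_summable g"
  shows "(\<lambda>i. inner (f i) (g i)) summable_on UNIV"
proof (rule abs_summable_summable, rule summable_on_comparison_test)
  show "(\<lambda>i. (norm (f i))\<^sup>2 + (norm (g i))\<^sup>2) summable_on UNIV"
    using assms unfolding sq_summable_def by (rule summable_on_add)
  fix i
  have "\<bar>inner (f i) (g i)\<bar> \<le> norm (f i) * norm (g i)" by (rule Cauchy_Schwarz_ineq2)
  also have "\<dots> \<le> (norm (f i))\<^sup>2 + (norm (g i))\<^sup>2"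
    using sum_squares_bound[of "norm (f i)" "norm (g i)"]
      mult_nonneg_nonneg[OF norm_ge_zero[of "f i"] norm_ge_zero[of "g i"]] by linarith
  finally show "norm (inner (f i) (g i)) \<le> (norm (f i))\<^sup>2 + (norm (g i))\<^sup>2" by simp
qed auto

section \<open>The Hilbert space of square-summable families\<close>

typedef (overloaded) ('i, 'k) l2 = "{f :: 'i \<Rightarrow> 'k::chilbert. sq_summable f}"
  morphisms coef Abs_l2
  by (rule exI[of _ "\<lambda>_. 0"]) (simp add: sq_summable_def)

setup_lifting type_definition_l2

lemma coef_sq_summable: "sq_summable (coef x)"
  using coef by blast

lemma coef_Abs: "sq_summable f \<Longrightarrow> coef (Abs_l2 f) = f"
  by (simp add: Abs_l2_inverse)

lemma l2_eqI: "(\<And>i. coef x i = coef y i) \<Longrightarrow> x = y"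
  using coef_inject by blast

instantiation l2 :: (type, chilbert) real_vector
begin

lift_definition zero_l2 :: "('a, 'b) l2" is "\<lambda>_. 0"
  by (simp add: sq_summable_def)
lift_definition plus_l2 :: "('a, 'b) l2 \<Rightarrow> ('a, 'b) l2 \<Rightarrow> ('a, 'b) l2" is "\<lambda>f g i. f i + g i"
  by (rule sq_summable_add)
lift_definition minus_l2 :: "('a, 'b) l2 \<Rightarrow> ('a, 'b) l2 \<Rightarrow> ('a, 'b) l2" is "\<lambda>f g i. f i - g i"
  by (rule sq_summable_diff)
lift_definition uminus_l2 :: "('a, 'b) l2 \<Rightarrow> ('a, 'b) l2" is "\<lambda>f i. - f i"
  by (rule sq_summable_uminus)
lift_definition scaleR_l2 :: "real \<Rightarrow> ('a, 'b) l2 \<Rightarrow> ('a, 'b) l2" is "\<lambda>r f i. r *\<^sub>R f i"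
  by (rule sq_summable_scaleR)

instance
  by standard (transfer; simp add: algebra_simps fun_eq_iff)+

end

lemma coef_0 [simp]: "coef 0 i = 0" by transfer simp
lemma coef_add [simp]: "coef (x + y) i = coef x i + coef y i" by transfer simp
lemma coef_diff [simp]: "coef (x - y) i = coef x i - coef y i" by transfer simp
lemma coef_scaleR [simp]: "coef (r *\<^sub>R x) i = r *\<^sub>R coef x i" by transfer simp

lemma coef_sum: "coef (\<Sum>a\<in>A. f a) i = (\<Sum>a\<in>A. coef (f a) i)"
  by (induction A rule: infinite_finite_induct) auto

instantiation l2 :: (type, chilbert) real_inner
begin

definition inner_l2 :: "('a, 'b) l2 \<Rightarrow> ('a, 'b) l2 \<Rightarrow> real" where
  "inner_l2 x y = (\<Sum>\<^sub>\<infinity>i. inner (coef x i) (coef y i))"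
definition norm_l2 :: "('a, 'b) l2 \<Rightarrow> real" where "norm_l2 x = sqrt (inner x x)"
definition dist_l2 :: "('a, 'b) l2 \<Rightarrow> ('a, 'b) l2 \<Rightarrow> real" where "dist_l2 x y = norm (x - y)"
definition sgn_l2 :: "('a, 'b) l2 \<Rightarrow> ('a, 'b) l2" where "sgn_l2 x = inverse (norm x) *\<^sub>R x"
definition uniformity_l2 :: "(('a, 'b) l2 \<times> ('a, 'b) l2) filter" where
  "uniformity_l2 = (INF e\<in>{0 <..}. principal {(x, y). dist x y < e})"
definition open_l2 :: "('a, 'b) l2 set \<Rightarrow> bool" where
  "open_l2 U = (\<forall>x\<in>U. eventually (\<lambda>(x', y). x' = x \<longrightarrow> y \<in> U) uniformity)"

instance
proof
  fix x y z :: "('a, 'b) l2" and r :: real and U :: "('a, 'b) l2 set"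
  show "dist x y = norm (x - y)" by (rule dist_l2_def)
  show "sgn x = inverse (norm x) *\<^sub>R x" by (rule sgn_l2_def)
  show "(uniformity :: (('a, 'b) l2 \<times> ('a, 'b) l2) filter) = (INF e\<in>{0 <..}. principal {(x, y). dist x y < e})"
    by (rule uniformity_l2_def)
  show "open U = (\<forall>x\<in>U. eventually (\<lambda>(x', y). x' = x \<longrightarrow> y \<in> U) uniformity)"
    by (rule open_l2_def)
  show "inner x y = inner y x" by (simp add: inner_l2_def inner_commute)
  show "inner (x + y) z = inner x z + inner y z"
    unfolding inner_l2_def
    by (subst infsum_add[symmetric])
       (auto simp: inner_add_left intro!: sq_summable_inner coef_sq_summable)
  show "inner (r *\<^sub>R x) y = r * inner x y"
    by (simp add: inner_l2_def infsum_cmult_right')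
  show "0 \<le> inner x x"
    unfolding inner_l2_def by (rule infsum_nonneg) simp
  show "inner x x = 0 \<longleftrightarrow> x = 0"
  proof
    assume "inner x x = 0"
    hence "inner (coef x i) (coef x i) = 0" for i
      unfolding inner_l2_def
      by (intro nonneg_infsum_le_0D[where A=UNIV and f="\<lambda>i. inner (coef x i) (coef x i)"])
         (auto intro: sq_summable_inner coef_sq_summable)
    thus "x = 0" by (intro l2_eqI) simp
  qed (simp add: inner_l2_def)
  show "norm x = sqrt (inner x x)" by (rule norm_l2_def)
qed

end

lemma norm_l2_sq: "(norm x)\<^sup>2 = (\<Sum>\<^sub>\<infinity>i. (norm (coef x i))\<^sup>2)"
  by (simp add: power2_norm_eq_inner inner_l2_def)

lemma sum_norm_coef_le: "finite F \<Longrightarrow> (\<Sum>i\<in>F. (norm (coef x i))\<^sup>2) \<le> (norm x)\<^sup>2"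
  unfolding norm_l2_sq
  by (rule finite_sum_le_infsum) (use coef_sq_summable in \<open>auto simp: sq_summable_def\<close>)

lemma norm_coef_le: "norm (coef x i) \<le> norm x"
proof -
  have "(norm (coef x i))\<^sup>2 \<le> (norm x)\<^sup>2" using sum_norm_coef_le[of "{i}" x] by simp
  thus ?thesis by (rule power2_le_imp_le) simp
qed

lemma bounded_linear_coef: "bounded_linear (\<lambda>x. coef x i)"
  by (rule bounded_linear_intro[where K=1]) (simp_all add: norm_coef_le)

instance l2 :: (type, chilbert) complete_space
proof
  fix X :: "nat \<Rightarrow> ('a, 'b) l2"
  assume X: "Cauchy X"
  have "\<exists>l. (\<lambda>k. coef (X k) i) \<longlonglongrightarrow> l" for i
    using bounded_linear.Cauchy[OF bounded_linear_coef X] by (simp add: Cauchy_convergent_iff convergent_def)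
  then obtain L where L: "\<And>i. (\<lambda>k. coef (X k) i) \<longlonglongrightarrow> L i" by metis
  \<comment> \<open>Over a finite index set the limit in \<open>k\<close> is taken term by term. As
    the bound does not depend on \<open>F\<close>, it passes to the full sum without exchanging a
    limit with an infinite sum.\<close>
  have bd: "(\<Sum>i\<in>F. (norm (coef (X m) i - L i))\<^sup>2) \<le> e\<^sup>2"
    if N: "\<And>k. k \<ge> N \<Longrightarrow> norm (X m - X k) \<le> e" and F: "finite F" and e: "e \<ge> 0" for N m e F
  proof (rule LIMSEQ_le_const2)
    show "(\<lambda>k. \<Sum>i\<in>F. (norm (coef (X m) i - coef (X k) i))\<^sup>2) \<longlonglongrightarrow> (\<Sum>i\<in>F. (norm (coef (X m) i - L i))\<^sup>2)"
      by (intro tendsto_intros L)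
    have "(\<Sum>i\<in>F. (norm (coef (X m) i - coef (X k) i))\<^sup>2) \<le> e\<^sup>2" if "k \<ge> N" for k
      using sum_norm_coef_le[OF F, of "X m - X k"] power_mono[OF N[OF that] norm_ge_zero, of 2] by simp
    thus "\<exists>N. \<forall>k\<ge>N. (\<Sum>i\<in>F. (norm (coef (X m) i - coef (X k) i))\<^sup>2) \<le> e\<^sup>2" by blast
  qed
  have C: "\<exists>N. \<forall>m\<ge>N. \<forall>k\<ge>N. norm (X m - X k) \<le> e" if "e > 0" for e
    using CauchyD[OF X that] less_imp_le by meson
  obtain N where N: "\<And>m k. m \<ge> N \<Longrightarrow> k \<ge> N \<Longrightarrow> norm (X m - X k) \<le> 1" using C[of 1] by auto
  have d: "sq_summable (\<lambda>i. coef (X N) i - L i)"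
    by (rule sq_summable_bdd(1)[where C="1\<^sup>2"]) (rule bd[of N N 1]; use N in auto)
  have Ls: "sq_summable L" using sq_summable_diff[OF coef_sq_summable[of "X N"] d] by simp
  have "X \<longlonglongrightarrow> Abs_l2 L"
  proof (rule LIMSEQ_I)
    fix r :: real assume "r > 0"
    then obtain N where N: "\<And>m k. m \<ge> N \<Longrightarrow> k \<ge> N \<Longrightarrow> norm (X m - X k) \<le> r/2"
      using C[of "r/2"] by auto
    have "norm (X m - Abs_l2 L) < r" if m: "m \<ge> N" for m
    proof -
      have "(norm (X m - Abs_l2 L))\<^sup>2 \<le> (r/2)\<^sup>2"
        unfolding norm_l2_sq
        by (rule sq_summable_bdd(2)) (use bd[of N m "r/2"] N m \<open>r > 0\<close> in \<open>auto simp: coef_Abs[OF Ls]\<close>)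
      hence "norm (X m - Abs_l2 L) \<le> r/2" by (rule power2_le_imp_le) (use \<open>r > 0\<close> in simp)
      thus ?thesis using \<open>r > 0\<close> by simp
    qed
    thus "\<exists>no. \<forall>n\<ge>no. norm (X n - Abs_l2 L) < r" by blast
  qed
  thus "convergent X" by (auto simp: convergent_def)
qed

instantiation l2 :: (type, chilbert) chilbert
begin

lift_definition cJ_l2 :: "('a, 'b) l2 \<Rightarrow> ('a, 'b) l2" is "\<lambda>f i. cJ (f i)"
  by (rule sq_summable_cJ)

instance
proof
  fix x y :: "('a, 'b) l2" and r :: real
  show "cJ (x + y) = cJ x + cJ y" by transfer (simp add: cJ_add)
  show "cJ (r *\<^sub>R x) = r *\<^sub>R cJ x" by transfer (simp add: cJ_scaleR)
  show "cJ (cJ x) = - x" by transfer (simp add: cJ_cJ)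
  show "inner (cJ x) (cJ y) = inner x y"
    unfolding inner_l2_def by transfer (simp add: cJ_inner)
qed

end

lemma coef_cJ [simp]: "coef (cJ x) i = cJ (coef x i)" by transfer simp

section \<open>The Fock space as a Hilbert space\<close>

type_synonym 'k fockspace = "(nat list, 'k) l2"

section \<open>Shifts, backward shifts and vacuum vectors\<close>

lemma shiftw_append [simp]: "shiftw \<alpha> f (\<alpha> @ w) = f w"
  by (simp add: shiftw_def)

lemma shiftw_outside: "w \<notin> range ((@) \<alpha>) \<Longrightarrow> shiftw \<alpha> f w = 0"
  unfolding shiftw_def by (metis append_take_drop_id rangeI)

lemma shift_eq_shiftw: "shift i f = shiftw [i] f"
  by (auto simp: shift_def shiftw_def fun_eq_iff split: list.split)

lemma has_sum_range_append:
  assumes "\<And>w. w \<notin> range ((@) \<alpha>) \<Longrightarrow> g w = 0"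
  shows "(g has_sum s) UNIV \<longleftrightarrow> ((\<lambda>w. g (\<alpha> @ w)) has_sum s) UNIV"
proof -
  have "(g has_sum s) UNIV \<longleftrightarrow> (g has_sum s) (range ((@) \<alpha>))"
    by (rule has_sum_cong_neutral) (use assms in auto)
  also have "\<dots> \<longleftrightarrow> ((\<lambda>w. g (\<alpha> @ w)) has_sum s) UNIV"
    by (subst has_sum_reindex) (auto simp: inj_on_def o_def)
  finally show ?thesis .
qed

lemma sq_summable_shiftw: "sq_summable f \<Longrightarrow> sq_summable (shiftw \<alpha> f)"
  unfolding sq_summable_def summable_on_def
  by (subst has_sum_range_append[of \<alpha>]) (auto simp: shiftw_outside)

lift_definition fsh :: "nat list \<Rightarrow> 'k::chilbert fockspace \<Rightarrow> 'k fockspace" is shiftw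
  by (rule sq_summable_shiftw)

lemma sq_summable_comp_inj: "sq_summable f \<Longrightarrow> inj g \<Longrightarrow> sq_summable (\<lambda>i. f (g i))"
  unfolding sq_summable_def
  using summable_on_reindex[of g UNIV "\<lambda>i. (norm (f i))\<^sup>2"]
  by (auto simp: o_def intro: summable_on_subset_banach)

text \<open>The adjoint of \<open>fsh \<alpha>\<close> and at the same time a left inverse of
  it.\<close>

lift_definition fbk :: "nat list \<Rightarrow> 'k::chilbert fockspace \<Rightarrow> 'k fockspace" is "\<lambda>\<alpha> f w. f (\<alpha> @ w)"
  by (rule sq_summable_comp_inj) (auto simp: inj_def)

lemma sq_summable_vac: "sq_summable (vac h)"
  unfolding sq_summable_def vac_def
  by (rule finite_nonzero_values_imp_summable_on, rule finite_subset[of _ "{[]}"]) auto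

lift_definition fvac :: "'k::chilbert \<Rightarrow> 'k fockspace" is vac
  by (rule sq_summable_vac)

lemma coef_fsh: "coef (fsh \<alpha> x) = shiftw \<alpha> (coef x)" by transfer simp
lemma coef_fsh_append [simp]: "coef (fsh \<alpha> x) (\<alpha> @ w) = coef x w" by (simp add: coef_fsh)
lemma coef_fsh_outside: "w \<notin> range ((@) \<alpha>) \<Longrightarrow> coef (fsh \<alpha> x) w = 0"
  by (simp add: coef_fsh shiftw_outside)
lemma coef_fbk [simp]: "coef (fbk \<alpha> x) w = coef x (\<alpha> @ w)" by transfer simp
lemma coef_fvac: "coef (fvac h) = vac h" by transfer simp
lemma Abs_vac: "Abs_l2 (vac h) = fvac h" by (metis coef_fvac coef_inverse)
lemma coef_fvac_Nil [simp]: "coef (fvac h) [] = h" by (simp add: coef_fvac vac_def)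
lemma coef_fvac_Cons [simp]: "coef (fvac h) (i # w) = 0" by (simp add: coef_fvac vac_def)
lemma coef_fsh_Cons_Nil [simp]: "coef (fsh (i # \<alpha>) x) [] = 0" by (simp add: coef_fsh shiftw_def)
lemma coef_fsh_singleton [simp]: "coef (fsh [i] x) (j # w) = (if i = j then coef x w else 0)"
  by (simp add: coef_fsh shiftw_def)

lemma coef_fsh_fvac: "coef (fsh w (fvac h)) u = (if w = u then h else 0)"
proof (cases "u \<in> range ((@) w)")
  case True
  then obtain v where "u = w @ v" by blast
  thus ?thesis using coef_fsh_append[of w "fvac h" v] by (cases v) auto
next
  case False
  hence "w \<noteq> u" using rangeI[of "(@) w" "[]"] by auto
  thus ?thesis using False by (simp add: coef_fsh_outside)
qed

lemma fsh_add: "fsh \<alpha> (x + y) = fsh \<alpha> x + fsh \<alpha> y"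
  by (rule l2_eqI) (simp add: coef_fsh shiftw_def)
lemma fsh_scaleR: "fsh \<alpha> (r *\<^sub>R x) = r *\<^sub>R fsh \<alpha> x"
  by (rule l2_eqI) (simp add: coef_fsh shiftw_def)
lemma fsh_cJ: "fsh \<alpha> (cJ x) = cJ (fsh \<alpha> x)"
  by (rule l2_eqI) (simp add: coef_fsh shiftw_def cJ_0)
lemma fsh_0 [simp]: "fsh \<alpha> 0 = 0"
  by (rule l2_eqI) (simp add: coef_fsh shiftw_def)
lemma fsh_Nil [simp]: "fsh [] x = x"
  by (rule l2_eqI) (simp add: coef_fsh shiftw_def)
lemma fsh_append: "fsh (\<alpha> @ \<beta>) x = fsh \<alpha> (fsh \<beta> x)"
proof (rule l2_eqI)
  fix w
  show "coef (fsh (\<alpha> @ \<beta>) x) w = coef (fsh \<alpha> (fsh \<beta> x)) w"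
  proof (cases "w \<in> range ((@) \<alpha>)")
    case True
    then obtain v where v: "w = \<alpha> @ v" by blast
    show ?thesis
    proof (cases "v \<in> range ((@) \<beta>)")
      case True
      then obtain u where "v = \<beta> @ u" by blast
      thus ?thesis using coef_fsh_append[of "\<alpha> @ \<beta>" x u] by (simp add: v)
    next
      case False
      hence "w \<notin> range ((@) (\<alpha> @ \<beta>))" by (auto simp: v)
      thus ?thesis using False by (simp add: v coef_fsh_outside)
    qed
  next
    case False
    hence "w \<notin> range ((@) (\<alpha> @ \<beta>))" by auto
    thus ?thesis using False by (simp add: coef_fsh_outside)
  qed
qed

lemma fsh_Cons: "fsh (i # \<alpha>) x = fsh [i] (fsh \<alpha> x)"
  using fsh_append[of "[i]" \<alpha> x] by simp

lemma fbk_fsh [simp]: "fbk \<alpha> (fsh \<alpha> x) = x"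
  by (rule l2_eqI) simp

lemma fbk_fsh_neq: "i \<noteq> j \<Longrightarrow> fbk [j] (fsh [i] x) = 0"
  by (rule l2_eqI) simp

lemma inner_fsh: "inner (fsh \<alpha> x) y = inner x (fbk \<alpha> y)"
proof -
  have "(\<lambda>w. inner (coef x w) (coef (fbk \<alpha> y) w)) summable_on UNIV"
    by (intro sq_summable_inner coef_sq_summable)
  hence "((\<lambda>w. inner (coef x w) (coef y (\<alpha> @ w))) has_sum inner x (fbk \<alpha> y)) UNIV"
    unfolding inner_l2_def by (simp add: has_sum_infsum)
  hence "((\<lambda>w. inner (coef (fsh \<alpha> x) w) (coef y w)) has_sum inner x (fbk \<alpha> y)) UNIV"
    by (subst has_sum_range_append[of \<alpha>]) (auto simp: coef_fsh_outside)
  thus ?thesis unfolding inner_l2_def by (rule infsumI)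
qed

lemma inner_fsh_fsh [simp]: "inner (fsh \<alpha> x) (fsh \<alpha> y) = inner x y"
  by (simp add: inner_fsh)

lemma norm_fsh [simp]: "norm (fsh \<alpha> x) = norm x"
  by (simp add: norm_eq_sqrt_inner)

lemma inner_fsh_neq: "i \<noteq> j \<Longrightarrow> inner (fsh [i] x) (fsh [j] y) = 0"
  by (simp add: inner_fsh fbk_fsh_neq)

lemma bounded_linear_fsh: "bounded_linear (fsh \<alpha>)"
  by (rule bounded_linear_intro[where K=1]) (simp_all add: fsh_add fsh_scaleR)

lemma bounded_linear_fbk: "bounded_linear (fbk \<alpha>)"
proof (rule bounded_linear_intro[where K=1])
  fix x :: "'a fockspace"
  have "norm (fbk \<alpha> x) * norm (fbk \<alpha> x) = inner (fsh \<alpha> (fbk \<alpha> x)) x"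
    by (simp add: inner_fsh power2_norm_eq_inner[symmetric] power2_eq_square)
  also have "\<dots> \<le> norm (fbk \<alpha> x) * norm x"
    using norm_cauchy_schwarz[of "fsh \<alpha> (fbk \<alpha> x)" x] by simp
  finally show "norm (fbk \<alpha> x) \<le> norm x * 1"
    by (metis mult.right_neutral mult_le_cancel_left_pos norm_ge_zero order_le_less)
qed (auto intro: l2_eqI)

lemma fvac_add: "fvac (x + y) = fvac x + fvac y"
  by (rule l2_eqI) (simp add: coef_fvac vac_def)
lemma fvac_scaleR: "fvac (r *\<^sub>R x) = r *\<^sub>R fvac x"
  by (rule l2_eqI) (simp add: coef_fvac vac_def)
lemma fvac_cJ: "fvac (cJ x) = cJ (fvac x)"
  by (rule l2_eqI) (simp add: coef_fvac vac_def cJ_0)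

lemma inner_fvac: "inner (fvac h) x = inner h (coef x [])"
proof -
  have "inner (fvac h) x = (\<Sum>\<^sub>\<infinity>w\<in>{[]}. inner (coef (fvac h) w) (coef x w))"
    unfolding inner_l2_def by (rule infsum_cong_neutral) (auto simp: coef_fvac vac_def)
  thus ?thesis by simp
qed

lemma norm_fvac [simp]: "norm (fvac h) = norm h"
  by (simp add: norm_eq_sqrt_inner inner_fvac)

lemma words_Nil [simp]: "[] \<in> words n" by (simp add: words_def)
lemma words_Cons [simp]: "i # w \<in> words n \<longleftrightarrow> i < n \<and> w \<in> words n" by (auto simp: words_def)
lemma words_append [simp]: "v @ w \<in> words n \<longleftrightarrow> v \<in> words n \<and> w \<in> words n"
  by (auto simp: words_def)

section \<open>The Fock space over a coefficient subspace\<close>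

definition fockl :: "nat \<Rightarrow> 'k::chilbert set \<Rightarrow> 'k fockspace set" where
  "fockl n K = {x. (\<forall>w. coef x w \<in> K) \<and> (\<forall>w. w \<notin> words n \<longrightarrow> coef x w = 0)}"

lemma fockl_iff_fock: "x \<in> fockl n K \<longleftrightarrow> coef x \<in> fock n K"
  using coef_sq_summable[of x] by (simp add: fockl_def fock_def sq_summable_def)

lemma fock_sq_summable: "f \<in> fock n K \<Longrightarrow> sq_summable f"
  by (simp add: fock_def sq_summable_def)

lemma fock_coef_Abs: "f \<in> fock n K \<Longrightarrow> coef (Abs_l2 f) = f"
  by (simp add: fock_sq_summable coef_Abs)

lemma fock_Abs: "f \<in> fock n K \<Longrightarrow> Abs_l2 f \<in> fockl n K"
  by (simp add: fockl_iff_fock fock_coef_Abs)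

lemma fnorm_coef: "fnorm (coef x) = norm x"
  unfolding fnorm_def norm_l2_sq[symmetric] by simp

lemma csubspace_fockl:
  assumes K: "csubspace K"
  shows "csubspace (fockl n K)"
  unfolding csubspace_def
proof (intro conjI ballI)
  note S = csubspaceD(1)[OF K]
  show "subspace (fockl n K)"
    unfolding subspace_def fockl_def
    by (auto simp: subspace_0[OF S] subspace_add[OF S] subspace_scale[OF S])
  show "cJ x \<in> fockl n K" if "x \<in> fockl n K" for x
    using that csubspaceD(3)[OF K] by (auto simp: fockl_def cJ_0)
  have c: "continuous_on UNIV (\<lambda>x :: 'a fockspace. coef x w)" for w :: "nat list"
    by (rule linear_continuous_on[OF bounded_linear_coef])
  have "closed {x. coef x w \<in> K}" for w :: "nat list"
    using continuous_on_closed_vimage[of UNIV "\<lambda>x. coef x w"] c[of w] csubspaceD(2)[OF K]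
    by (auto simp: vimage_def)
  moreover have "closed {x. w \<notin> words n \<longrightarrow> coef x w = (0::'a)}" for w
    by (cases "w \<in> words n") (auto intro!: closed_Collect_eq c continuous_intros)
  ultimately show "closed (fockl n K)"
    unfolding fockl_def by (intro closed_Collect_conj closed_Collect_all)
qed

lemma csubspace_UNIV: "csubspace UNIV"
  by (simp add: csubspace_def)

context
  fixes K :: "'k::chilbert set" and n :: nat
  assumes K: "csubspace K"
begin

lemma fsh_fockl: "\<alpha> \<in> words n \<Longrightarrow> x \<in> fockl n K \<Longrightarrow> fsh \<alpha> x \<in> fockl n K"
proof -
  assume \<alpha>: "\<alpha> \<in> words n" and x: "x \<in> fockl n K"
  have "coef (fsh \<alpha> x) w \<in> K \<and> (w \<notin> words n \<longrightarrow> coef (fsh \<alpha> x) w = 0)" for w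
  proof (cases "w \<in> range ((@) \<alpha>)")
    case True
    thus ?thesis using \<alpha> x by (auto simp: fockl_def)
  next
    case False
    thus ?thesis using subspace_0[OF csubspaceD(1)[OF K]] by (simp add: coef_fsh_outside)
  qed
  thus ?thesis by (simp add: fockl_def)
qed

lemma fbk_fockl: "x \<in> fockl n K \<Longrightarrow> fbk \<alpha> x \<in> fockl n K"
  by (auto simp: fockl_def)

lemma fvac_fockl: "h \<in> K \<Longrightarrow> fvac h \<in> fockl n K"
  using subspace_0[OF csubspaceD(1)[OF K]] by (auto simp: fockl_def coef_fvac vac_def)

end

text \<open>A word is empty or starts with a letter below \<open>n\<close>, so the vacuum projection
  and the range projections of the shifts add up to the identity. Inductions on words rest on this
  splitting.\<close>

lemma fockl_decomp:
  assumes "x \<in> fockl n K"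
  shows "x = fvac (coef x []) + (\<Sum>j<n. fsh [j] (fbk [j] x))"
proof (rule l2_eqI)
  fix w
  show "coef x w = coef (fvac (coef x []) + (\<Sum>j<n. fsh [j] (fbk [j] x))) w"
  proof (cases w)
    case (Cons i v)
    have "i \<ge> n \<Longrightarrow> coef x (i # v) = 0" using assms by (auto simp: fockl_def)
    thus ?thesis by (auto simp: Cons coef_sum)
  qed (simp add: coef_sum)
qed

section \<open>Inner operators and generated invariant subspaces\<close>

definition generated :: "nat \<Rightarrow> ('a::chilbert \<Rightarrow> 'k::chilbert fockspace) \<Rightarrow> 'k fockspace set" where
  "generated n \<theta> = closure (span (\<Union>\<alpha>\<in>words n. fsh \<alpha> ` range \<theta>))"

definition innerl :: "nat \<Rightarrow> 'k::chilbert set \<Rightarrow> 'l::chilbert set \<Rightarrow> ('k fockspace \<Rightarrow> 'l fockspace) \<Rightarrow> bool" where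
  "innerl n K L M \<longleftrightarrow> lin_on (fockl n K) M \<and> M ` fockl n K \<subseteq> fockl n L
     \<and> (\<forall>x\<in>fockl n K. norm (M x) = norm x)
     \<and> (\<forall>i<n. \<forall>x\<in>fockl n K. M (fsh [i] x) = fsh [i] (M x))"

lemma innerlD:
  assumes "innerl n K L M"
  shows "lin_on (fockl n K) M" "x \<in> fockl n K \<Longrightarrow> M x \<in> fockl n L"
    "x \<in> fockl n K \<Longrightarrow> norm (M x) = norm x"
    "i < n \<Longrightarrow> x \<in> fockl n K \<Longrightarrow> M (fsh [i] x) = fsh [i] (M x)"
  using assms by (auto simp: innerl_def)

lemma innerl_fsh:
  assumes M: "innerl n K L M" and K: "csubspace K"
  shows "\<alpha> \<in> words n \<Longrightarrow> x \<in> fockl n K \<Longrightarrow> M (fsh \<alpha> x) = fsh \<alpha> (M x)"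
proof (induction \<alpha>)
  case (Cons i \<alpha>)
  thus ?case
    using innerlD(4)[OF M, of i "fsh \<alpha> x"] fsh_fockl[OF K]
    by (simp add: fsh_Cons[of i \<alpha>])
qed simp

lemma innerl_inj_on:
  assumes "innerl n K L M" "csubspace K"
  shows "inj_on M (fockl n K)"
  using lin_on_isometric_inj_on innerlD(1,3)[OF assms(1)] csubspaceD(1)[OF csubspace_fockl[OF assms(2)]]
  by blast

lemma innerl_image_generated:
  assumes M: "innerl n K L M" and K: "csubspace K" and \<psi>: "\<And>x. \<psi> x \<in> fockl n K"
  shows "M ` generated n \<psi> = generated n (\<lambda>x. M (\<psi> x))"
proof -
  note F = csubspace_fockl[OF K, of n]
  have S: "(\<Union>\<alpha>\<in>words n. fsh \<alpha> ` range \<psi>) \<subseteq> fockl n K"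
    using \<psi> fsh_fockl[OF K] by auto
  have "M ` (\<Union>\<alpha>\<in>words n. fsh \<alpha> ` range \<psi>) = (\<Union>\<alpha>\<in>words n. fsh \<alpha> ` range (\<lambda>x. M (\<psi> x)))"
    unfolding image_UN image_image
    by (intro SUP_cong image_cong refl) (use innerl_fsh[OF M K] \<psi> in auto)
  thus ?thesis
    unfolding generated_def
    using lin_on_isometric_closure_span[OF innerlD(1)[OF M] csubspaceD(1,2)[OF F] innerlD(3)[OF M] S]
    by simp
qed

text \<open>\<open>Z\<close> is the inverse of \<open>N\<close> after \<open>M\<close>. It commutes
  with the shifts because \<open>N\<close> and \<open>M\<close> do and \<open>N\<close> can be
  cancelled.\<close>

lemma innerl_inverse:
  assumes M: "innerl n K L M" and K: "csubspace K" and N: "innerl n K' L N" and K': "csubspace K'"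
    and eq: "M ` fockl n K = N ` fockl n K'"
  obtains Z where "innerl n K K' Z" "Z ` fockl n K = fockl n K'" "\<And>x. x \<in> fockl n K \<Longrightarrow> N (Z x) = M x"
proof -
  obtain Z where Z_lin: "lin_on (fockl n K) Z" and Z: "\<And>x. x \<in> fockl n K \<Longrightarrow> Z x \<in> fockl n K'"
    "\<And>x. x \<in> fockl n K \<Longrightarrow> N (Z x) = M x" "\<And>x. x \<in> fockl n K \<Longrightarrow> norm (Z x) = norm (M x)"
    by (rule lin_on_factor[OF innerlD(1)[OF M] csubspace_fockl[OF K] innerlD(1)[OF N] csubspace_fockl[OF K']
          innerlD(3)[OF N]]) (use eq in auto)
  have inj: "u = v" if "u \<in> fockl n K'" "v \<in> fockl n K'" "N u = N v" for u v
    using inj_onD[OF innerl_inj_on[OF N K']] that by blast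
  have "innerl n K K' Z"
    unfolding innerl_def
  proof (intro conjI allI ballI impI)
    show "norm (Z x) = norm x" if "x \<in> fockl n K" for x
      using innerlD(3)[OF M that] Z(3)[OF that] by simp
    show "Z (fsh [i] x) = fsh [i] (Z x)" if "i < n" "x \<in> fockl n K" for i x
      by (rule inj) (simp_all add: Z that fsh_fockl[OF K] fsh_fockl[OF K'] innerlD(4)[OF M] innerlD(4)[OF N])
  qed (use Z_lin Z in auto)
  moreover have "Z ` fockl n K = fockl n K'"
  proof
    show "fockl n K' \<subseteq> Z ` fockl n K"
    proof
      fix y assume y: "y \<in> fockl n K'"
      then obtain x where x: "x \<in> fockl n K" "N y = M x" using eq by blast
      hence "Z x = y" using inj[OF Z(1) y] Z(2) by simp
      thus "y \<in> Z ` fockl n K" using x by blast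
    qed
  qed (use Z in auto)
  ultimately show ?thesis using that Z(2) by blast
qed

text \<open>Given the inner factor, outerness of \<open>\<psi>\<close> depends only on the range of
  \<open>M\<close> and on the composite symbol. Existence thus becomes the search for an inner
  operator with a prescribed range, and uniqueness starts from two inner operators of equal
  range.\<close>

lemma generated_eq_fockl_iff:
  assumes M: "innerl n K L M" and K: "csubspace K" and \<psi>: "\<And>x. \<psi> x \<in> fockl n K"
  shows "generated n \<psi> = fockl n K \<longleftrightarrow> M ` fockl n K = generated n (\<lambda>x. M (\<psi> x))"
proof -
  have "generated n \<psi> \<subseteq> fockl n K"
    using \<psi> fsh_fockl[OF K] unfolding generated_def
    by (intro closure_minimal span_minimal csubspaceD[OF csubspace_fockl[OF K]]) auto
  hence "generated n \<psi> = fockl n K \<longleftrightarrow> M ` generated n \<psi> = M ` fockl n K"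
    using inj_on_image_eq_iff[OF innerl_inj_on[OF M K]] by blast
  thus ?thesis using innerl_image_generated[where \<psi>=\<psi>, OF M K \<psi>] by auto
qed

lemma innerl_inner:
  assumes "innerl n K L M" "csubspace K" "x \<in> fockl n K" "y \<in> fockl n K"
  shows "inner (M x) (M y) = inner x y"
  using lin_on_isometric_inner[OF innerlD(1)[OF assms(1)] csubspaceD(1)[OF csubspace_fockl[OF assms(2)]]]
    innerlD(3)[OF assms(1)] assms(3,4) by blast

text \<open>By adjointness the inner product in the hypothesis is the squared norm of
  \<open>fbk [i] x\<close>, so one test vector per letter detects a vacuum vector.\<close>

lemma fockl_eq_fvac:
  assumes "x \<in> fockl n K" "\<And>i. i < n \<Longrightarrow> inner (fsh [i] (fbk [i] x)) x = 0"
  shows "x = fvac (coef x [])"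
proof -
  have "fbk [i] x = 0" if "i < n" for i
    using assms(2)[OF that] by (simp add: inner_fsh)
  thus ?thesis using fockl_decomp[OF assms(1)] by simp
qed

text \<open>\<open>Z\<close> preserves the orthogonal complement of the ranges of the shifts, that is, the vacuum component.\<close>

lemma innerl_onto_unitary:
  assumes Z: "innerl n K L Z" and onto: "Z ` fockl n K = fockl n L" and K: "csubspace K" and L: "csubspace L"
  obtains U where "unitary_on K L U" "\<And>x w. x \<in> fockl n K \<Longrightarrow> coef (Z x) w = U (coef x w)"
proof -
  define U where "U h = coef (Z (fvac h)) []" for h
  note FK = csubspace_fockl[OF K, of n] and FL = csubspace_fockl[OF L, of n]
  have Zv: "Z (fvac h) = fvac (U h)" if h: "h \<in> K" for h
    unfolding U_def
  proof (rule fockl_eq_fvac)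
    have v: "fvac h \<in> fockl n K" using fvac_fockl[OF K h] .
    thus z: "Z (fvac h) \<in> fockl n L" by (rule innerlD(2)[OF Z])
    fix i assume i: "i < n"
    \<comment> \<open>Surjectivity enters here: the test vector in the range of a target shift is
      the image of a shifted vector, and shifted vectors are orthogonal to the vacuum
      component.\<close>
    have "fbk [i] (Z (fvac h)) \<in> Z ` fockl n K" using fbk_fockl[OF L z] onto by simp
    then obtain g where g: "g \<in> fockl n K" "fbk [i] (Z (fvac h)) = Z g" by blast
    have "inner (fsh [i] (Z g)) (Z (fvac h)) = inner (fsh [i] g) (fvac h)"
      using innerl_inner[OF Z K fsh_fockl[OF K _ g(1)] v, of "[i]"] innerlD(4)[OF Z i g(1)] i by simp
    also have "\<dots> = 0" by (simp add: inner_commute[of _ "fvac h"] inner_fvac)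
    finally show "inner (fsh [i] (fbk [i] (Z (fvac h)))) (Z (fvac h)) = 0" using g(2) by simp
  qed
  have lin: "lin_on K U"
    unfolding lin_on_def U_def
    using lin_onD[OF innerlD(1)[OF Z]] fvac_fockl[OF K]
    by (simp add: fvac_add fvac_scaleR fvac_cJ)
  have norm: "norm (U h) = norm h" if "h \<in> K" for h
    using innerlD(3)[OF Z fvac_fockl[OF K that]] Zv[OF that] by simp
  have "U ` K = L"
  proof
    show "U ` K \<subseteq> L"
      using innerlD(2)[OF Z fvac_fockl[OF K]] unfolding U_def fockl_def by auto
    show "L \<subseteq> U ` K"
    proof
      fix y assume y: "y \<in> L"
      then obtain x where x: "x \<in> fockl n K" "Z x = fvac y" using onto fvac_fockl[OF L y] by (metis imageE)
      \<comment> \<open>The same argument for the inverse direction: the preimage of a vacuum vector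
        is a vacuum vector, which makes \<open>U\<close> surjective.\<close>
      have "x = fvac (coef x [])"
      proof (rule fockl_eq_fvac[OF x(1)])
        fix i assume i: "i < n"
        have b: "fbk [i] x \<in> fockl n K" by (rule fbk_fockl[OF K x(1)])
        have "inner (fsh [i] (fbk [i] x)) x = inner (fsh [i] (Z (fbk [i] x))) (Z x)"
          using innerl_inner[OF Z K fsh_fockl[OF K _ b] x(1), of "[i]"] innerlD(4)[OF Z i b] i by simp
        also have "\<dots> = 0" by (simp add: x(2) inner_commute[of _ "fvac y"] inner_fvac)
        finally show "inner (fsh [i] (fbk [i] x)) x = 0" .
      qed
      hence "U (coef x []) = y" using x(2) by (metis U_def coef_fvac_Nil)
      moreover have "coef x [] \<in> K" using x(1) by (simp add: fockl_def)
      ultimately show "y \<in> U ` K" by blast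
    qed
  qed
  hence "unitary_on K L U" using lin norm by (simp add: unitary_on_def)
  moreover have "coef (Z x) w = U (coef x w)" if "x \<in> fockl n K" for x w
    using that
  proof (induction w arbitrary: x)
    \<comment> \<open>Comparing coefficients at \<open>i # v\<close> in this splitting reduces the
      claim for \<open>x\<close> to the claim for \<open>fbk [i] x\<close> at
      \<open>v\<close>.\<close>
    have dec: "Z x = fvac (U (coef x [])) + (\<Sum>j<n. fsh [j] (Z (fbk [j] x)))" if x: "x \<in> fockl n K" for x
    proof -
      have b: "fsh [j] (fbk [j] x) \<in> fockl n K" if "j < n" for j
        using that fsh_fockl[OF K _ fbk_fockl[OF K x]] by simp
      have c: "coef x [] \<in> K" using x by (simp add: fockl_def)
      have "Z x = Z (fvac (coef x []) + (\<Sum>j<n. fsh [j] (fbk [j] x)))"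
        using fockl_decomp[OF x] by simp
      also have "\<dots> = Z (fvac (coef x [])) + Z (\<Sum>j<n. fsh [j] (fbk [j] x))"
        using b csubspaceD(1)[OF FK]
        by (intro lin_onD(1)[OF innerlD(1)[OF Z]] fvac_fockl[OF K c]) (auto intro: subspace_sum)
      also have "Z (\<Sum>j<n. fsh [j] (fbk [j] x)) = (\<Sum>j<n. Z (fsh [j] (fbk [j] x)))"
        using b by (intro lin_on_sum[OF innerlD(1)[OF Z] csubspaceD(1)[OF FK]]) auto
      also have "\<dots> = (\<Sum>j<n. fsh [j] (Z (fbk [j] x)))"
        using innerlD(4)[OF Z] fbk_fockl[OF K x] by (intro sum.cong) auto
      finally show ?thesis using Zv[OF c] by simp
    qed
    {
      case Nil
      show ?case by (subst dec[OF Nil]) (simp add: coef_sum)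
    next
      case (Cons i v)
      show ?case
      proof (cases "i < n")
        case True
        thus ?thesis
          by (subst dec[OF Cons.prems]) (simp add: coef_sum Cons.IH[OF fbk_fockl[OF K Cons.prems]])
      next
        case False
        have "coef x (i # v) = 0" "coef (Z x) (i # v) = 0"
          using False Cons.prems innerlD(2)[OF Z Cons.prems] by (auto simp: fockl_def)
        thus ?thesis using lin_on_0[OF lin] subspace_0[OF csubspaceD(1)[OF K]] by simp
      qed
    }
  qed
  ultimately show ?thesis using that by blast
qed

section \<open>The Wold decomposition of a generated subspace\<close>

locale fock_symbol =
  fixes n :: nat and \<theta> :: "'a::chilbert \<Rightarrow> 'b::chilbert fockspace" and C :: real
  assumes lin: "lin_on UNIV \<theta>" and bdd: "\<And>x. norm (\<theta> x) \<le> C * norm x"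
    and fock: "\<And>x. \<theta> x \<in> fockl n UNIV"
begin

abbreviation N :: "'b fockspace set" where "N \<equiv> generated n \<theta>"

definition R :: "'b fockspace set" where "R = closure (span (\<Union>i\<in>{..<n}. fsh [i] ` N))"

definition W :: "'b fockspace set" where
  "W = {x \<in> N. \<forall>i<n. \<forall>y\<in>N. inner x (fsh [i] y) = 0}"

lemma N_csubspace: "csubspace N"
  unfolding generated_def
proof (rule csubspace_closure_span)
  fix x assume "x \<in> (\<Union>\<alpha>\<in>words n. fsh \<alpha> ` range \<theta>)"
  then obtain \<alpha> h where "\<alpha> \<in> words n" "x = fsh \<alpha> (\<theta> h)" by blast
  moreover from this have "cJ x = fsh \<alpha> (\<theta> (cJ h))" by (simp add: fsh_cJ lin_onD[OF lin])
  ultimately show "cJ x \<in> (\<Union>\<alpha>\<in>words n. fsh \<alpha> ` range \<theta>)" by blast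
qed

lemmas N_subspace = csubspaceD(1)[OF N_csubspace]
  and N_closed = csubspaceD(2)[OF N_csubspace]

lemma generator_in_N: "\<alpha> \<in> words n \<Longrightarrow> fsh \<alpha> (\<theta> x) \<in> N"
  unfolding generated_def by (rule subsetD[OF closure_subset], rule span_base) blast

lemma N_fockl: "N \<subseteq> fockl n UNIV"
  unfolding generated_def
  using fsh_fockl[OF csubspace_UNIV _ fock]
  by (intro closure_minimal span_minimal csubspaceD[OF csubspace_fockl[OF csubspace_UNIV]]) blast

lemma fsh_N: "i < n \<Longrightarrow> x \<in> N \<Longrightarrow> fsh [i] x \<in> N"
proof -
  assume i: "i < n" and x: "x \<in> N"
  let ?S = "\<Union>\<alpha>\<in>words n. fsh \<alpha> ` range \<theta>"
  have "fsh [i] ` N \<subseteq> closure (fsh [i] ` span ?S)"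
    unfolding generated_def by (rule closure_bounded_linear_image_subset[OF bounded_linear_fsh])
  also have "fsh [i] ` span ?S = span (fsh [i] ` ?S)"
    by (rule linear_span_image[symmetric]) (simp add: bounded_linear_fsh bounded_linear.linear)
  also have "fsh [i] ` ?S \<subseteq> ?S"
  proof
    fix y assume "y \<in> fsh [i] ` ?S"
    then obtain \<alpha> h where "\<alpha> \<in> words n" "y = fsh [i] (fsh \<alpha> (\<theta> h))" by blast
    hence "\<alpha> \<in> words n" "y = fsh (i # \<alpha>) (\<theta> h)" using fsh_Cons by metis+
    moreover from this have "i # \<alpha> \<in> words n" using i by simp
    ultimately show "y \<in> ?S" by blast
  qed
  hence "closure (span (fsh [i] ` ?S)) \<subseteq> N"
    unfolding generated_def by (intro closure_mono span_mono)
  finally show ?thesis using x by blast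
qed

lemma fshw_N: "\<alpha> \<in> words n \<Longrightarrow> x \<in> N \<Longrightarrow> fsh \<alpha> x \<in> N"
proof (induction \<alpha>)
  case (Cons i \<alpha>)
  thus ?case using fsh_N[of i "fsh \<alpha> x"] by (simp add: fsh_Cons[of i \<alpha>])
qed simp

lemma R_csubspace: "csubspace R"
  unfolding R_def
proof (rule csubspace_closure_span)
  fix x assume "x \<in> (\<Union>i\<in>{..<n}. fsh [i] ` N)"
  thus "cJ x \<in> (\<Union>i\<in>{..<n}. fsh [i] ` N)"
    using csubspaceD(3)[OF N_csubspace] by (fastforce simp flip: fsh_cJ)
qed

lemmas R_proj = csubspaceD(1,2)[OF R_csubspace]

lemma R_N: "R \<subseteq> N"
  unfolding R_def using fsh_N N_subspace N_closed by (intro closure_minimal span_minimal) auto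

lemma fsh_R: "i < n \<Longrightarrow> x \<in> N \<Longrightarrow> fsh [i] x \<in> R"
  unfolding R_def by (rule subsetD[OF closure_subset]) (auto intro: span_base)

lemma W_orth_R: "x \<in> W \<Longrightarrow> y \<in> R \<Longrightarrow> inner x y = 0"
  unfolding R_def by (rule inner_zero_closure_span) (auto simp: W_def)

lemma W_subspace: "subspace W"
  using N_subspace unfolding subspace_def W_def by (auto simp: inner_add_left)

lemma W_N: "x \<in> W \<Longrightarrow> x \<in> N"
  by (simp add: W_def)

lemma diff_hproj_W: "x \<in> N \<Longrightarrow> x - hproj R x \<in> W"
  using hproj_in[OF R_proj, of x] R_N N_subspace hproj_orth[OF R_proj fsh_R]
  unfolding W_def by (auto intro: subspace_diff)

text \<open>Equal first letters cancel, and different first letters have orthogonal ranges. If one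
  word ends first, a vector of \<open>W\<close> meets a shifted element of \<open>N\<close>, to
  which it is orthogonal by definition.\<close>

lemma W_orth_shifts:
  assumes x: "x \<in> W" and y: "y \<in> W"
  shows "\<alpha> \<in> words n \<Longrightarrow> \<beta> \<in> words n \<Longrightarrow> inner (fsh \<alpha> x) (fsh \<beta> y) = (if \<alpha> = \<beta> then inner x y else 0)"
proof (induction \<alpha> arbitrary: \<beta>)
  case Nil
  show ?case
  proof (cases \<beta>)
    case (Cons j \<beta>')
    hence "inner x (fsh [j] (fsh \<beta>' y)) = 0"
      using Nil.prems x W_N[OF y] fshw_N[of \<beta>' y] by (simp add: W_def)
    thus ?thesis using Cons by (simp add: fsh_Cons[of j \<beta>'])
  qed simp
next
  case (Cons i \<alpha>')
  show ?case
  proof (cases \<beta>)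
    case Nil
    have "inner y (fsh [i] (fsh \<alpha>' x)) = 0"
      using Cons.prems y W_N[OF x] fshw_N[of \<alpha>' x] by (simp add: W_def)
    thus ?thesis using Nil by (simp add: fsh_Cons[of i \<alpha>'] inner_commute)
  next
    case (Cons j \<beta>')
    have "inner (fsh (i # \<alpha>') x) (fsh (j # \<beta>') y) = inner (fsh [i] (fsh \<alpha>' x)) (fsh [j] (fsh \<beta>' y))"
      by (simp only: fsh_Cons[of i \<alpha>'] fsh_Cons[of j \<beta>'])
    thus ?thesis
      using Cons.IH[of \<beta>'] Cons.prems Cons by (cases "i = j") (simp_all add: inner_fsh_neq)
  qed
qed

text \<open>The conditions hold for shifted elements of \<open>N\<close> and survive sums and
  limits. They permit a descent: an element of \<open>R\<close> has no vacuum component, and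
  removing a first letter leads back into \<open>N\<close>.\<close>

lemma R_components: "y \<in> R \<Longrightarrow> coef y [] = 0 \<and> (\<forall>i<n. fbk [i] y \<in> N)"
proof -
  let ?Q = "{z. coef z [] = 0 \<and> (\<forall>i. i < n \<longrightarrow> fbk [i] z \<in> N)}"
  interpret b: bounded_linear "fbk \<alpha> :: 'b fockspace \<Rightarrow> _" for \<alpha> by (rule bounded_linear_fbk)
  have "subspace ?Q"
    using N_subspace by (auto simp: subspace_def b.add b.scaleR b.zero)
  moreover have "closed {z. fbk [i] z \<in> N}" for i
    using continuous_on_closed_vimage[of UNIV "fbk [i] :: 'b fockspace \<Rightarrow> _"] N_closed
      linear_continuous_on[OF bounded_linear_fbk] by (auto simp: vimage_def)
  hence "closed ?Q"
    by (intro closed_Collect_conj closed_Collect_all closed_Collect_imp closed_Collect_eq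
        linear_continuous_on bounded_linear_coef continuous_intros) auto
  moreover have "fsh [j] x \<in> ?Q" if "x \<in> N" for j x
    using that subspace_0[OF N_subspace] by (auto simp: fbk_fsh_neq) (metis fbk_fsh fbk_fsh_neq)
  ultimately have "R \<subseteq> ?Q" unfolding R_def by (intro closure_minimal span_minimal) auto
  thus "y \<in> R \<Longrightarrow> ?thesis" by blast
qed

text \<open>Pureness of the shift: the components of \<open>y\<close> vanish one letter of the word at a time.\<close>

lemma wold_zero:
  assumes "y \<in> N" "\<And>\<alpha> x. \<alpha> \<in> words n \<Longrightarrow> x \<in> W \<Longrightarrow> inner y (fsh \<alpha> x) = 0"
  shows "y = 0"
proof -
  have "coef y w = 0" for w
    using assms
  proof (induction w arbitrary: y)
    \<comment> \<open>Only the empty word is needed here: the residue \<open>?u\<close> lies in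
      \<open>W\<close> and is orthogonal to \<open>y\<close> and to the projection of
      \<open>y\<close>, hence to itself.\<close>
    have in_R: "y \<in> R" if "y \<in> N" "\<And>\<alpha> x. \<alpha> \<in> words n \<Longrightarrow> x \<in> W \<Longrightarrow> inner y (fsh \<alpha> x) = 0" for y
    proof -
      let ?u = "y - hproj R y"
      have u: "?u \<in> W" by (rule diff_hproj_W) fact
      have "inner y ?u = 0" using that(2)[OF words_Nil u] by simp
      moreover have "inner (hproj R y) ?u = 0"
        using W_orth_R[OF u hproj_in[OF R_proj]] by (simp add: inner_commute)
      ultimately have "inner ?u ?u = 0" by (simp add: inner_diff_left)
      thus ?thesis using hproj_in[OF R_proj, of y] by simp
    qed
    {
      case Nil
      show ?case using R_components[OF in_R[OF Nil]] by blast
    next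
      case (Cons i v)
      show ?case
      proof (cases "i < n")
        case True
        have "coef (fbk [i] y) v = 0"
        \<comment> \<open>The orthogonality hypothesis is inherited: pairing
          \<open>fbk [i] y\<close> with the word \<open>\<alpha>\<close> is pairing \<open>y\<close>
          with \<open>i # \<alpha>\<close>.\<close>
        proof (rule Cons.IH)
          show "fbk [i] y \<in> N" using R_components[OF in_R[OF Cons.prems]] True by blast
          fix \<alpha> x assume "\<alpha> \<in> words n" "x \<in> W"
          hence "inner y (fsh (i # \<alpha>) x) = 0" using Cons.prems(2)[of "i # \<alpha>" x] True by simp
          thus "inner (fbk [i] y) (fsh \<alpha> x) = 0"
            by (simp add: fsh_Cons[of i \<alpha>] inner_commute[of y] inner_commute[of "fbk [i] y"] inner_fsh)
        qed
        thus ?thesis by simp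
      next
        case False
        thus ?thesis using N_fockl Cons.prems(1) by (auto simp: fockl_def)
      qed
    }
  qed
  thus ?thesis by (intro l2_eqI) simp
qed

text \<open>The compression of \<open>\<theta>\<close> to \<open>W\<close>: on \<open>N\<close> the
  projection onto \<open>W\<close> is the identity minus the projection onto
  \<open>R\<close>.\<close>

definition T :: "'a \<Rightarrow> 'b fockspace" where "T x = \<theta> x - hproj R (\<theta> x)"

lemma \<theta>_N: "\<theta> x \<in> N"
  using generator_in_N[OF words_Nil] by simp

lemma T_lin: "lin_on UNIV T"
  unfolding lin_on_def T_def
  by (simp add: lin_onD[OF lin] hproj_add[OF R_proj] hproj_scaleR[OF R_proj]
      hproj_cJ[OF R_proj csubspaceD(3)[OF R_csubspace]] cJ_diff scaleR_diff_right)

text \<open>A vector of \<open>W\<close> orthogonal to the range of \<open>T\<close> is orthogonal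
  to the range of \<open>\<theta>\<close>, because \<open>W\<close> is orthogonal to
  \<open>R\<close>. It is orthogonal to the properly shifted generators by definition of
  \<open>W\<close>, hence to all of \<open>N\<close>, which contains it.\<close>

lemma closure_range_T: "closure (range T) = W"
proof (rule closed_subspace_eq_if_orth_zero)
  have "T ` span UNIV = span (range T)"
    by (rule lin_on_span_image[OF T_lin]) auto
  hence rs: "subspace (range T)" by (metis span_UNIV subspace_span)
  show "subspace (closure (range T))" by (rule subspace_closure[OF rs])
  have "closed W"
  proof -
    have "closed {x. inner x (fsh [i] y) = 0}" for i and y :: "'b fockspace"
      by (intro closed_Collect_eq continuous_intros)
    moreover have "W = N \<inter> (\<Inter>i\<in>{..<n}. \<Inter>y\<in>N. {x. inner x (fsh [i] y) = 0})"
      by (auto simp: W_def)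
    ultimately show ?thesis using N_closed by (auto intro!: closed_INT closed_Int)
  qed
  moreover have "range T \<subseteq> W" using diff_hproj_W[OF \<theta>_N] by (auto simp: T_def)
  ultimately show "closure (range T) \<subseteq> W" by (intro closure_minimal)
  fix y assume y: "y \<in> W" and orth: "\<And>x. x \<in> closure (range T) \<Longrightarrow> inner y x = 0"
  have y\<theta>: "inner y (\<theta> x) = 0" for x
  proof -
    have "inner y (T x) = 0" by (rule orth, rule subsetD[OF closure_subset rangeI])
    moreover have "inner y (hproj R (\<theta> x)) = 0" by (rule W_orth_R[OF y hproj_in[OF R_proj]])
    ultimately show ?thesis by (simp add: T_def inner_diff_right)
  qed
  have "inner y x = 0" if x: "x \<in> (\<Union>\<alpha>\<in>words n. fsh \<alpha> ` range \<theta>)" for x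
  proof -
    obtain \<alpha> h where a: "\<alpha> \<in> words n" "x = fsh \<alpha> (\<theta> h)" using x by blast
    show ?thesis
    proof (cases \<alpha>)
      case (Cons i \<beta>)
      thus ?thesis using y a generator_in_N[of \<beta> h] by (simp add: W_def fsh_Cons[of i \<beta>])
    qed (simp add: a y\<theta>)
  qed
  hence "inner y y = 0"
    using W_N[OF y] unfolding generated_def by (rule inner_zero_closure_span)
  thus "y = 0" by simp
qed (simp_all add: W_subspace)

lemma wandering_coordinates:
  obtains K :: "'a set" and V where "csubspace K" "lin_on K V" "V ` K = W" "\<And>x. x \<in> K \<Longrightarrow> norm (V x) = norm x"
proof -
  have "norm (T x) \<le> C * norm x" for x
    using norm_hproj_diff_le[OF R_proj, of "\<theta> x"] bdd[of x] unfolding T_def by linarith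
  from closure_range_isometric[OF T_lin this] show ?thesis
    using that unfolding closure_range_T by blast
qed

end

section \<open>Finitely supported elements\<close>

definition fin_supp :: "nat \<Rightarrow> 'k::chilbert set \<Rightarrow> 'k fockspace set" where
  "fin_supp n K = {x \<in> fockl n K. finite {w. coef x w \<noteq> 0}}"

context
  fixes K :: "'k::chilbert set" and n :: nat
  assumes K: "csubspace K"
begin

lemma fin_supp_subspace: "subspace (fin_supp n K)"
proof -
  note F = csubspaceD(1)[OF csubspace_fockl[OF K, of n]]
  have "finite {w. coef (x + y) w \<noteq> 0}" if "finite {w. coef x w \<noteq> 0}" "finite {w. coef y w \<noteq> 0}"
    for x y :: "'k fockspace"
    by (rule finite_subset[OF _ finite_UnI[OF that]]) auto
  moreover have "finite {w. coef (r *\<^sub>R x) w \<noteq> 0}" if "finite {w. coef x w \<noteq> 0}"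
    for x :: "'k fockspace" and r
    by (rule finite_subset[OF _ that]) auto
  ultimately show ?thesis
    unfolding subspace_def fin_supp_def
    by (auto simp: subspace_0[OF F] subspace_add[OF F] subspace_scale[OF F] simp del: coef_add coef_scaleR)
qed

lemma fin_supp_cJ: "x \<in> fin_supp n K \<Longrightarrow> cJ x \<in> fin_supp n K"
  using csubspaceD(3)[OF csubspace_fockl[OF K]]
  unfolding fin_supp_def by (auto elim!: finite_subset[rotated] simp: cJ_0)

lemma fin_supp_fsh: "\<alpha> \<in> words n \<Longrightarrow> x \<in> fin_supp n K \<Longrightarrow> fsh \<alpha> x \<in> fin_supp n K"
proof -
  assume a: "\<alpha> \<in> words n" "x \<in> fin_supp n K"
  have "{w. coef (fsh \<alpha> x) w \<noteq> 0} \<subseteq> (@) \<alpha> ` {w. coef x w \<noteq> 0}"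
  proof
    fix w assume w: "w \<in> {w. coef (fsh \<alpha> x) w \<noteq> 0}"
    hence "w \<in> range ((@) \<alpha>)" using coef_fsh_outside by blast
    thus "w \<in> (@) \<alpha> ` {w. coef x w \<noteq> 0}" using w by auto
  qed
  moreover have "finite ((@) \<alpha> ` {w. coef x w \<noteq> 0})" using a by (simp add: fin_supp_def)
  ultimately show ?thesis
    using a fsh_fockl[OF K] finite_subset unfolding fin_supp_def by blast
qed

lemma fin_supp_fvac: "h \<in> K \<Longrightarrow> fvac h \<in> fin_supp n K"
proof -
  assume "h \<in> K"
  moreover have "finite {w. coef (fvac h) w \<noteq> 0}"
    by (rule finite_subset[of _ "{[]}"]) (auto simp: coef_fvac vac_def)
  ultimately show ?thesis using fvac_fockl[OF K] by (simp add: fin_supp_def)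
qed

text \<open>Pairing \<open>y\<close> with the vector that carries \<open>coef y w\<close> at the
  single word \<open>w\<close> yields the squared norm of that coefficient.\<close>

lemma closure_fin_supp: "closure (fin_supp n K) = fockl n K"
proof (rule closed_subspace_eq_if_orth_zero)
  note F = csubspace_fockl[OF K, of n]
  show "subspace (closure (fin_supp n K))" by (rule subspace_closure[OF fin_supp_subspace])
  show "subspace (fockl n K)" by (rule csubspaceD[OF F])
  show "closure (fin_supp n K) \<subseteq> fockl n K"
    using csubspaceD(2)[OF F] by (intro closure_minimal) (auto simp: fin_supp_def)
  fix y assume y: "y \<in> fockl n K" and orth: "\<And>x. x \<in> closure (fin_supp n K) \<Longrightarrow> inner y x = 0"
  show "y = 0"
  proof (rule l2_eqI)
    fix w
    show "coef y w = coef 0 w"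
    proof (cases "w \<in> words n")
      case True
      have "coef y w \<in> K" using y by (simp add: fockl_def)
      hence "fsh w (fvac (coef y w)) \<in> fin_supp n K"
        by (intro fin_supp_fsh fin_supp_fvac True)
      hence "inner y (fsh w (fvac (coef y w))) = 0" using orth closure_subset by blast
      hence "inner (fvac (coef y w)) (fbk w y) = 0" by (simp add: inner_commute[of y] inner_fsh)
      thus ?thesis by (simp add: inner_fvac)
    next
      case False
      thus ?thesis using y by (simp add: fockl_def)
    qed
  qed
qed simp

end

section \<open>The inner operator onto the generated subspace\<close>

context fock_symbol
begin

text \<open>\<open>M\<close> extends \<open>\<Sum>\<^sub>w e\<^sub>w \<otimes> h\<^sub>w \<mapsto> \<Sum>\<^sub>w S\<^sub>w (V h\<^sub>w)\<close>, where \<open>V\<close> identifies \<open>K\<close> with the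
  wandering subspace.\<close>

lemma inner_operator_exists:
  shows "\<exists>(K :: 'a set) M. csubspace K \<and> innerl n K UNIV M \<and> M ` fockl n K = N"
proof -
  obtain K :: "'a set" and V where K: "csubspace K" and V: "lin_on K V" and VK: "V ` K = W"
    and Vn: "\<And>x. x \<in> K \<Longrightarrow> norm (V x) = norm x"
    by (rule wandering_coordinates) blast
  define D where "D = fin_supp n K"
  define J where "J x = (\<Sum>w | coef x w \<noteq> 0. fsh w (V (coef x w)))" for x
  note Ks = csubspaceD(1)[OF K]
  have V0: "V 0 = 0" using lin_on_0[OF V] subspace_0[OF Ks] .
  have VW: "V h \<in> W" if "h \<in> K" for h using that VK by blast
  have D: "subspace D" "\<And>x. x \<in> D \<Longrightarrow> cJ x \<in> D"
    unfolding D_def using fin_supp_subspace[OF K] fin_supp_cJ[OF K] by blast+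
  have DK: "coef x w \<in> K" if "x \<in> D" for x w using that by (simp add: D_def fin_supp_def fockl_def)
  have Dfin: "finite {w. coef x w \<noteq> 0}" if "x \<in> D" for x using that by (simp add: D_def fin_supp_def)
  have Dw: "w \<in> words n" if "x \<in> D" "coef x w \<noteq> 0" for x w
    using that by (auto simp: D_def fin_supp_def fockl_def)
  \<comment> \<open>As \<open>V 0 = 0\<close>, any finite superset of the support serves as index
    set, so elements with different supports can be summed over a common one.\<close>
  have J_eq: "J x = (\<Sum>w\<in>A. fsh w (V (coef x w)))" if "finite A" "{w. coef x w \<noteq> 0} \<subseteq> A" for x A
    unfolding J_def by (rule sum.mono_neutral_left[OF that]) (auto simp: V0)
  have J_lin: "lin_on D J"
    unfolding lin_on_def
  proof (intro conjI ballI allI)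
    fix x y assume xy: "x \<in> D" "y \<in> D"
    define A where "A = {w. coef x w \<noteq> 0} \<union> {w. coef y w \<noteq> 0}"
    have A: "finite A" using Dfin xy by (simp add: A_def)
    have "J (x + y) = (\<Sum>w\<in>A. fsh w (V (coef (x + y) w)))"
      by (rule J_eq[OF A]) (auto simp: A_def)
    also have "\<dots> = (\<Sum>w\<in>A. fsh w (V (coef x w))) + (\<Sum>w\<in>A. fsh w (V (coef y w)))"
      using DK xy by (simp add: lin_onD[OF V] fsh_add sum.distrib)
    also have "\<dots> = J x + J y"
      using J_eq[OF A, of x] J_eq[OF A, of y] by (auto simp: A_def)
    finally show "J (x + y) = J x + J y" .
  next
    fix x r assume x: "x \<in> D"
    have "J (r *\<^sub>R x) = (\<Sum>w | coef x w \<noteq> 0. fsh w (V (coef (r *\<^sub>R x) w)))"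
      by (rule J_eq[OF Dfin[OF x]]) auto
    thus "J (r *\<^sub>R x) = r *\<^sub>R J x"
      using DK[OF x] by (simp add: J_def lin_onD[OF V] fsh_scaleR scaleR_sum_right)
  next
    fix x assume x: "x \<in> D"
    have "J (cJ x) = (\<Sum>w | coef x w \<noteq> 0. fsh w (V (coef (cJ x) w)))"
      by (rule J_eq[OF Dfin[OF x]]) (auto simp: cJ_0)
    thus "J (cJ x) = cJ (J x)"
      using DK[OF x] by (simp add: J_def lin_onD[OF V] fsh_cJ cJ_sum)
  qed
  have J_norm: "norm (J x) = norm x" if x: "x \<in> D" for x
  proof -
    let ?A = "{w. coef x w \<noteq> 0}"
    have "(norm (J x))\<^sup>2 = (\<Sum>v\<in>?A. \<Sum>w\<in>?A. inner (fsh v (V (coef x v))) (fsh w (V (coef x w))))"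
      unfolding power2_norm_eq_inner J_def by (simp add: inner_sum_left inner_sum_right) (rule sum.swap)
    also have "\<dots> = (\<Sum>v\<in>?A. \<Sum>w\<in>?A. if v = w then (norm (coef x v))\<^sup>2 else 0)"
    proof (intro sum.cong refl)
      fix v w assume "v \<in> ?A" "w \<in> ?A"
      thus "inner (fsh v (V (coef x v))) (fsh w (V (coef x w))) = (if v = w then (norm (coef x v))\<^sup>2 else 0)"
        using W_orth_shifts[OF VW VW, of "coef x v" "coef x w" v w] DK[OF x] Dw[OF x] Vn
        by (auto simp: power2_norm_eq_inner[symmetric])
    qed
    also have "\<dots> = (\<Sum>v\<in>?A. (norm (coef x v))\<^sup>2)"
      using Dfin[OF x] by simp
    also have "\<dots> = (\<Sum>\<^sub>\<infinity>v\<in>?A. (norm (coef x v))\<^sup>2)" using Dfin[OF x] by simp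
    also have "\<dots> = (norm x)\<^sup>2"
      unfolding norm_l2_sq by (rule infsum_cong_neutral) auto
    finally show ?thesis by simp
  qed
  have J_fsh: "J (fsh \<alpha> x) = fsh \<alpha> (J x)" if x: "x \<in> D" for x \<alpha>
  proof -
    let ?A = "{w. coef x w \<noteq> 0}"
    have "J (fsh \<alpha> x) = (\<Sum>w\<in>(@) \<alpha> ` ?A. fsh w (V (coef (fsh \<alpha> x) w)))"
    proof (rule J_eq)
      show "{w. coef (fsh \<alpha> x) w \<noteq> 0} \<subseteq> (@) \<alpha> ` ?A"
      proof
        fix w assume w: "w \<in> {w. coef (fsh \<alpha> x) w \<noteq> 0}"
        hence "w \<in> range ((@) \<alpha>)" using coef_fsh_outside by blast
        thus "w \<in> (@) \<alpha> ` ?A" using w by auto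
      qed
    qed (use Dfin[OF x] in simp)
    also have "\<dots> = (\<Sum>w\<in>?A. fsh \<alpha> (fsh w (V (coef x w))))"
      by (subst sum.reindex) (auto simp: inj_on_def fsh_append)
    also have "\<dots> = fsh \<alpha> (J x)"
      unfolding J_def
      by (rule linear_sum[symmetric]) (simp add: bounded_linear_fsh bounded_linear.linear)
    finally show ?thesis .
  qed
  have J_fvac: "J (fvac h) = V h" for h
  proof -
    have "{w. coef (fvac h) w \<noteq> 0} \<subseteq> {[]}" by (auto simp: coef_fvac vac_def split: if_splits)
    thus ?thesis using J_eq[of "{[]}" "fvac h"] by simp
  qed
  obtain M where M: "lin_on (closure D) M" "\<And>x. x \<in> closure D \<Longrightarrow> norm (M x) = norm x"
    "M ` closure D = closure (J ` D)" "\<And>x. x \<in> D \<Longrightarrow> M x = J x"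
    by (rule lin_on_isometric_extension[OF D J_lin J_norm]) blast+
  have cD: "closure D = fockl n K" unfolding D_def by (rule closure_fin_supp[OF K])
  \<comment> \<open>\<open>J\<close> takes the vector with value \<open>h\<close> at the single word
    \<alpha> to \<open>fsh \<alpha> (V h)\<close>, and by the Wold decomposition no nonzero vector
    of \<open>N\<close> is orthogonal to all of these.\<close>
  have JN: "closure (J ` D) = N"
  proof (rule closed_subspace_eq_if_orth_zero)
    have "J ` span D = span (J ` D)" by (rule lin_on_span_image[OF J_lin D(1)]) simp
    hence "subspace (J ` D)" using D(1) by (metis span_eq_iff subspace_span)
    thus "subspace (closure (J ` D))" by (rule subspace_closure)
    have "J x \<in> N" if "x \<in> D" for x
      unfolding J_def using that Dw DK VW W_N fshw_N by (intro subspace_sum[OF N_subspace]) blast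
    thus "closure (J ` D) \<subseteq> N" using N_closed by (intro closure_minimal) auto
    fix y assume y: "y \<in> N" and orth: "\<And>x. x \<in> closure (J ` D) \<Longrightarrow> inner y x = 0"
    show "y = 0"
    proof (rule wold_zero[OF y])
      fix \<alpha> x assume a: "\<alpha> \<in> words n" and "x \<in> W"
      then obtain h where h: "h \<in> K" "x = V h" using VK by blast
      have v: "fvac h \<in> D" unfolding D_def by (rule fin_supp_fvac[OF K h(1)])
      hence "J (fsh \<alpha> (fvac h)) = fsh \<alpha> x" using J_fsh J_fvac h by simp
      moreover have "fsh \<alpha> (fvac h) \<in> D" using v fin_supp_fsh[OF K a] by (simp add: D_def)
      ultimately have "fsh \<alpha> x \<in> closure (J ` D)" using closure_subset by (metis image_eqI subsetD)
      thus "inner y (fsh \<alpha> x) = 0" by (rule orth)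
    qed
  qed (simp_all add: N_subspace)
  have comm: "M (fsh [i] x) = fsh [i] (M x)" if i: "i < n" and x: "x \<in> closure D" for i x
  proof -
    have sD: "subspace (closure D)" by (rule subspace_closure[OF D(1)])
    have cM: "continuous_on (closure D) M" by (rule lin_on_isometric_continuous[OF M(1) sD M(2)])
    have "continuous_on (closure D) (\<lambda>x. M (fsh [i] x) - fsh [i] (M x))"
    proof (intro continuous_on_diff)
      show "continuous_on (closure D) (\<lambda>x. M (fsh [i] x))"
        by (rule continuous_on_compose2[OF cM linear_continuous_on[OF bounded_linear_fsh]])
           (use i fsh_fockl[OF K] in \<open>auto simp: cD\<close>)
      show "continuous_on (closure D) (\<lambda>x. fsh [i] (M x))"
        by (rule continuous_on_compose2[OF linear_continuous_on[OF bounded_linear_fsh] cM]) auto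
    qed
    moreover have "M (fsh [i] y) - fsh [i] (M y) = 0" if y: "y \<in> D" for y
    proof -
      have "fsh [i] y \<in> D" using y fin_supp_fsh[OF K] i by (simp add: D_def)
      thus ?thesis using M(4) J_fsh y by simp
    qed
    ultimately have "M (fsh [i] x) - fsh [i] (M x) = 0"
      using x by (rule continuous_constant_on_closure)
    thus ?thesis by simp
  qed
  have "innerl n K UNIV M"
    using M(1,2,3) JN N_fockl comm unfolding innerl_def cD by auto
  thus ?thesis using K M(3) JN cD by auto
qed

end

section \<open>Operators on coefficient functions\<close>

lemma fock_add:
  assumes "f \<in> fock n K" "g \<in> fock n K"
  shows "Abs_l2 (\<lambda>w. f w + g w) = Abs_l2 f + Abs_l2 g"
  by (rule l2_eqI)
     (simp add: coef_Abs sq_summable_add fock_sq_summable[OF assms(1)] fock_sq_summable[OF assms(2)])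

lemma fock_scaleR: "f \<in> fock n K \<Longrightarrow> Abs_l2 (\<lambda>w. r *\<^sub>R f w) = r *\<^sub>R Abs_l2 f"
  by (rule l2_eqI) (simp add: coef_Abs sq_summable_scaleR fock_sq_summable)

lemma fock_cJ: "f \<in> fock n K \<Longrightarrow> Abs_l2 (\<lambda>w. cJ (f w)) = cJ (Abs_l2 f)"
  by (rule l2_eqI) (simp add: coef_Abs sq_summable_cJ fock_sq_summable)

lemma fock_shift: "f \<in> fock n K \<Longrightarrow> Abs_l2 (shift i f) = fsh [i] (Abs_l2 f)"
  by (rule l2_eqI)
     (simp add: coef_fsh shift_eq_shiftw coef_Abs sq_summable_shiftw fock_sq_summable)

lemma coef_plus_fun: "coef (x + y) = (\<lambda>w. coef x w + coef y w)"
  and coef_scaleR_fun: "coef (r *\<^sub>R x) = (\<lambda>w. r *\<^sub>R coef x w)"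
  and coef_cJ_fun: "coef (cJ x) = (\<lambda>w. cJ (coef x w))"
  by auto

lemma fnorm_fock: "f \<in> fock n K \<Longrightarrow> fnorm f = norm (Abs_l2 f)"
  using fnorm_coef[of "Abs_l2 f"] by (simp add: fock_coef_Abs)

lemma coef_image_fockl: "coef ` fockl n K = fock n K"
proof
  show "fock n K \<subseteq> coef ` fockl n K"
    using fock_Abs fock_coef_Abs by (metis image_eqI subsetI)
qed (auto simp: fockl_iff_fock)

lemma symop_Abs:
  assumes \<psi>: "symop n UNIV K \<psi>"
  shows "lin_on UNIV (\<lambda>x. Abs_l2 (\<psi> x))" "\<And>x. Abs_l2 (\<psi> x) \<in> fockl n K"
    "\<exists>C. \<forall>x. norm (Abs_l2 (\<psi> x)) \<le> C * norm x" "\<And>x. coef (Abs_l2 (\<psi> x)) = \<psi> x"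
proof -
  have f: "\<psi> x \<in> fock n K" for x using \<psi> by (simp add: symop_def)
  show "lin_on UNIV (\<lambda>x. Abs_l2 (\<psi> x))"
    using \<psi> by (simp add: lin_on_def symop_def fock_add[OF f f] fock_scaleR[OF f] fock_cJ[OF f])
  show "Abs_l2 (\<psi> x) \<in> fockl n K" "coef (Abs_l2 (\<psi> x)) = \<psi> x" for x
    using fock_Abs[OF f] fock_coef_Abs[OF f] by auto
  show "\<exists>C. \<forall>x. norm (Abs_l2 (\<psi> x)) \<le> C * norm x"
    using \<psi> by (simp add: symop_def fnorm_fock[OF f])
qed

lemma symop_coef:
  assumes "lin_on UNIV \<psi>" "\<And>x. \<psi> x \<in> fockl n K" "\<And>x. norm (\<psi> x) \<le> C * norm x"
  shows "symop n UNIV K (\<lambda>x. coef (\<psi> x))"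
  using assms lin_onD[OF assms(1)]
  by (auto simp: symop_def fockl_iff_fock fnorm_coef)

lemma fop_Abs:
  assumes M: "fop n K L M"
  shows "lin_on (fockl n K) (\<lambda>x. Abs_l2 (M (coef x)))"
    "\<And>x. x \<in> fockl n K \<Longrightarrow> Abs_l2 (M (coef x)) \<in> fockl n L"
    "\<exists>C. \<forall>x\<in>fockl n K. norm (Abs_l2 (M (coef x))) \<le> C * norm x"
    "\<And>x. x \<in> fockl n K \<Longrightarrow> coef (Abs_l2 (M (coef x))) = M (coef x)"
proof -
  have f: "M (coef x) \<in> fock n L" if "x \<in> fockl n K" for x
    using M that by (simp add: fop_def fockl_iff_fock)
  show "lin_on (fockl n K) (\<lambda>x. Abs_l2 (M (coef x)))"
    using M f
    by (simp add: lin_on_def fop_def coef_plus_fun coef_scaleR_fun coef_cJ_fun fockl_iff_fock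
        fock_add[of _ n L] fock_scaleR[of _ n L] fock_cJ[of _ n L] del: coef_add coef_scaleR coef_cJ)
  show "Abs_l2 (M (coef x)) \<in> fockl n L" "coef (Abs_l2 (M (coef x))) = M (coef x)"
    if "x \<in> fockl n K" for x
    using fock_Abs[OF f[OF that]] fock_coef_Abs[OF f[OF that]] by auto
  obtain C where C: "\<forall>f\<in>fock n K. fnorm (M f) \<le> C * fnorm f"
    using M by (auto simp: fop_def)
  have "norm (Abs_l2 (M (coef x))) \<le> C * norm x" if "x \<in> fockl n K" for x
    using C that fnorm_fock[OF f[OF that]] by (auto simp: fockl_iff_fock fnorm_coef)
  thus "\<exists>C. \<forall>x\<in>fockl n K. norm (Abs_l2 (M (coef x))) \<le> C * norm x" by blast
qed

lemma multi_analytic_Abs_fsh: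
  assumes M: "multi_analytic n K L M" and "i < n" "x \<in> fockl n K"
  shows "Abs_l2 (M (coef (fsh [i] x))) = fsh [i] (Abs_l2 (M (coef x)))"
proof -
  have x: "coef x \<in> fock n K" using assms(3) by (simp add: fockl_iff_fock)
  hence Mx: "M (coef x) \<in> fock n L" using M by (simp add: multi_analytic_def fop_def)
  have "M (coef (fsh [i] x)) = shift i (M (coef x))"
    using M assms(2) x by (simp add: multi_analytic_def coef_fsh shift_eq_shiftw)
  thus ?thesis by (simp add: fock_shift[OF Mx])
qed

lemma innerl_Abs:
  assumes M: "inner_op n K L M"
  shows "innerl n K L (\<lambda>x. Abs_l2 (M (coef x)))"
proof -
  have MA: "multi_analytic n K L M" and F: "fop n K L M"
    using M by (auto simp: inner_op_def multi_analytic_def)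
  have "norm (Abs_l2 (M (coef x))) = norm x" if x: "x \<in> fockl n K" for x
  proof -
    have "fnorm (M (coef x)) = norm x" using M x by (simp add: inner_op_def fockl_iff_fock fnorm_coef)
    thus ?thesis using fop_Abs(4)[OF F x] by (metis fnorm_coef)
  qed
  thus ?thesis
    unfolding innerl_def using fop_Abs(1,2)[OF F] multi_analytic_Abs_fsh[OF MA] by auto
qed

lemma multi_analytic_coef:
  assumes M: "lin_on (fockl n K) M" "\<And>x. x \<in> fockl n K \<Longrightarrow> M x \<in> fockl n L"
    "\<And>x. x \<in> fockl n K \<Longrightarrow> norm (M x) \<le> C * norm x"
    "\<And>i x. i < n \<Longrightarrow> x \<in> fockl n K \<Longrightarrow> M (fsh [i] x) = fsh [i] (M x)"
  shows "multi_analytic n K L (\<lambda>f. coef (M (Abs_l2 f)))"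
  unfolding multi_analytic_def fop_def
proof (intro conjI ballI allI impI)
  show "\<exists>C. \<forall>f\<in>fock n K. fnorm (coef (M (Abs_l2 f))) \<le> C * fnorm f"
    using M(3)[OF fock_Abs] by (auto simp: fnorm_coef fnorm_fock intro!: exI[of _ C])
  fix f assume f: "f \<in> fock n K"
  show "coef (M (Abs_l2 f)) \<in> fock n L"
    using M(2)[OF fock_Abs[OF f]] by (simp add: fockl_iff_fock)
  show "coef (M (Abs_l2 (\<lambda>w. f w + g w))) = (\<lambda>w. coef (M (Abs_l2 f)) w + coef (M (Abs_l2 g)) w)"
    if "g \<in> fock n K" for g
    using lin_onD(1)[OF M(1) fock_Abs[OF f] fock_Abs[OF that]] fock_add[OF f that] by auto
  show "coef (M (Abs_l2 (\<lambda>w. r *\<^sub>R f w))) = (\<lambda>w. r *\<^sub>R coef (M (Abs_l2 f)) w)" for r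
    using lin_onD(2)[OF M(1) fock_Abs[OF f]] fock_scaleR[OF f] by auto
  show "coef (M (Abs_l2 (\<lambda>w. cJ (f w)))) = (\<lambda>w. cJ (coef (M (Abs_l2 f)) w))"
    using lin_onD(3)[OF M(1) fock_Abs[OF f]] fock_cJ[OF f] by auto
  show "coef (M (Abs_l2 (shift i f))) = shift i (coef (M (Abs_l2 f)))" if "i < n" for i
    unfolding fock_shift[OF f] using M(4)[OF that fock_Abs[OF f]]
    by (simp add: coef_fsh shift_eq_shiftw)
qed

lemma inner_op_coef:
  assumes M: "innerl n K L M"
  shows "inner_op n K L (\<lambda>f. coef (M (Abs_l2 f)))"
  unfolding inner_op_def
  using multi_analytic_coef[OF innerlD(1,2)[OF M], of 1] innerlD(3,4)[OF M] innerlD(3)[OF M fock_Abs]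
  by (auto simp: fnorm_coef fnorm_fock)

section \<open>Spans of coefficient functions and outerness\<close>

text \<open>Stability under \<open>cJ\<close> absorbs the imaginary parts of complex coefficients
  into a real combination. Conversely, the finite set of vectors in a real combination is
  enumerated, since \<open>fspan\<close> indexes its sums by natural numbers.\<close>

lemma fspan_coef_image:
  fixes S :: "'k::chilbert fockspace set"
  assumes S: "\<And>x. x \<in> S \<Longrightarrow> cJ x \<in> S"
  shows "fspan (coef ` S) = coef ` span S"
proof
  show "fspan (coef ` S) \<subseteq> coef ` span S"
  proof
    fix f assume "f \<in> fspan (coef ` S)"
    then obtain I :: "nat set" and c v where I: "finite I" "\<forall>i\<in>I. v i \<in> coef ` S"
      and f: "f = (\<lambda>w. \<Sum>i\<in>I. cscale (c i) (v i w))"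
      unfolding fspan_def by blast
    have "\<forall>i\<in>I. \<exists>u. u \<in> S \<and> v i = coef u" using I(2) by blast
    then obtain u where u: "\<And>i. i \<in> I \<Longrightarrow> u i \<in> S" "\<And>i. i \<in> I \<Longrightarrow> v i = coef (u i)" by metis
    define x where "x = (\<Sum>i\<in>I. Re (c i) *\<^sub>R u i + Im (c i) *\<^sub>R cJ (u i))"
    have "x \<in> span S" unfolding x_def using u(1) S by (intro span_sum span_add span_scale span_base) auto
    moreover have "f = coef x" using u(2) by (auto simp: f x_def coef_sum cscale_def)
    ultimately show "f \<in> coef ` span S" by blast
  qed
  show "coef ` span S \<subseteq> fspan (coef ` S)"
  proof
    fix f assume "f \<in> coef ` span S"
    then obtain x where x: "x \<in> span S" "f = coef x" by blast
    then obtain t r where t: "finite t" "t \<subseteq> S" "x = (\<Sum>a\<in>t. r a *\<^sub>R a)"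
      unfolding span_explicit by blast
    obtain h where h: "bij_betw h {0..<card t} t" using ex_bij_betw_nat_finite[OF t(1)] by blast
    have "f = (\<lambda>w. \<Sum>i\<in>{0..<card t}. cscale (complex_of_real (r (h i))) (coef (h i) w))"
      unfolding x(2) t(3) sum.reindex_bij_betw[OF h, symmetric]
      by (auto simp: coef_sum cscale_def)
    moreover have "coef (h i) \<in> coef ` S" if "i \<in> {0..<card t}" for i
      using bij_betwE[OF h] that t(2) by blast
    ultimately show "f \<in> fspan (coef ` S)"
      unfolding fspan_def mem_Collect_eq
      by (intro exI[of _ "{0..<card t}"] exI[of _ "\<lambda>i. complex_of_real (r (h i))"]
          exI[of _ "\<lambda>i. coef (h i)"]) auto
  qed
qed

lemma closed_fspan_coef_image:
  fixes S :: "'k::chilbert fockspace set"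
  assumes S: "\<And>x. x \<in> S \<Longrightarrow> cJ x \<in> S"
  shows "closed_fspan n K (coef ` S) = coef ` (fockl n K \<inter> closure (span S))"
proof -
  have *: "coef x \<in> closed_fspan n K (coef ` S) \<longleftrightarrow> x \<in> fockl n K \<inter> closure (span S)" for x
  proof -
    have "(\<lambda>w. coef x w - coef y w) = coef (x - y)" for y by auto
    hence "fnorm (\<lambda>w. coef x w - coef y w) = dist y x" for y
      by (simp add: fnorm_coef dist_norm norm_minus_commute)
    thus ?thesis
      using S by (simp add: closed_fspan_def fspan_coef_image fockl_iff_fock closure_approachable)
  qed
  show ?thesis
  proof
    show "closed_fspan n K (coef ` S) \<subseteq> coef ` (fockl n K \<inter> closure (span S))"
    proof
      fix f assume f: "f \<in> closed_fspan n K (coef ` S)"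
      hence "f \<in> coef ` fockl n K" by (simp add: closed_fspan_def coef_image_fockl)
      thus "f \<in> coef ` (fockl n K \<inter> closure (span S))" using f * by blast
    qed
  qed (use * in blast)
qed

text \<open>Outerness speaks of complex spans and \<open>generated\<close> of real ones. They agree
  because complex linearity of \<open>\<psi>\<close> makes the set of generators stable under
  \<open>cJ\<close>.\<close>

lemma outer_coef_iff:
  assumes K: "csubspace K" and \<psi>: "lin_on UNIV \<psi>" "\<And>x. \<psi> x \<in> fockl n K"
  shows "outer n UNIV K (\<lambda>x. coef (\<psi> x)) \<longleftrightarrow> generated n \<psi> = fockl n K"
proof -
  let ?S = "\<Union>\<alpha>\<in>words n. fsh \<alpha> ` range \<psi>"
  have cJ: "cJ x \<in> ?S" if "x \<in> ?S" for x
  proof -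
    obtain \<alpha> h where "\<alpha> \<in> words n" "x = fsh \<alpha> (\<psi> h)" using \<open>x \<in> ?S\<close> by blast
    moreover from this have "cJ x = fsh \<alpha> (\<psi> (cJ h))" by (simp add: fsh_cJ lin_onD[OF \<psi>(1)])
    ultimately show ?thesis by blast
  qed
  have "(\<Union>\<alpha>\<in>words n. shiftw \<alpha> ` (\<lambda>x. coef (\<psi> x)) ` UNIV) = coef ` ?S"
    by (simp add: image_UN image_image coef_fsh)
  hence "outer n UNIV K (\<lambda>x. coef (\<psi> x)) \<longleftrightarrow> coef ` (fockl n K \<inter> generated n \<psi>) = coef ` fockl n K"
    unfolding outer_def generated_def by (simp only: closed_fspan_coef_image[OF cJ] coef_image_fockl)
  also have "\<dots> \<longleftrightarrow> fockl n K \<inter> generated n \<psi> = fockl n K"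
    by (rule inj_image_eq_iff) (simp add: inj_def coef_inject)
  also have "generated n \<psi> \<subseteq> fockl n K"
    using \<psi>(2) fsh_fockl[OF K] unfolding generated_def
    by (intro closure_minimal span_minimal csubspaceD[OF csubspace_fockl[OF K]]) auto
  hence "(fockl n K \<inter> generated n \<psi> = fockl n K) \<longleftrightarrow> generated n \<psi> = fockl n K" by blast
  finally show ?thesis .
qed

lemma symop_symbol:
  assumes M: "multi_analytic n UNIV K M"
  shows "symop n UNIV K (symbol M)"
proof -
  have F: "fop n UNIV K M" using M by (simp add: multi_analytic_def)
  obtain C where C: "\<And>x. x \<in> fockl n UNIV \<Longrightarrow> norm (Abs_l2 (M (coef x))) \<le> C * norm x"
    using fop_Abs(3)[OF F] by blast
  have v: "fvac h \<in> fockl n UNIV" for h :: 'a by (rule fvac_fockl[OF csubspace_UNIV]) simp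
  have lin: "lin_on UNIV (\<lambda>h. Abs_l2 (M (coef (fvac h))))"
    using lin_onD[OF fop_Abs(1)[OF F]] v by (simp add: lin_on_def fvac_add fvac_scaleR fvac_cJ)
  have "symop n UNIV K (\<lambda>h. coef (Abs_l2 (M (coef (fvac h)))))"
    by (rule symop_coef[OF lin, of _ _ C]) (use fop_Abs(2)[OF F v] C[OF v] in auto)
  thus ?thesis using fop_Abs(4)[OF F v] by (simp add: coef_fvac symbol_def)
qed

section \<open>The factorization\<close>

lemma inner_outer_unique:
  fixes K :: "'c::chilbert set" and K' :: "'d::chilbert set" and \<theta> :: "'a::chilbert \<Rightarrow> nat list \<Rightarrow> 'b::chilbert"
  assumes K: "csubspace K" and \<psi>: "symop n UNIV K \<psi>" "outer n UNIV K \<psi>"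
    and M: "inner_op n K UNIV M" and \<theta>: "\<And>x. \<theta> x = M (\<psi> x)"
    and K': "csubspace K'" and \<psi>': "symop n UNIV K' \<psi>'" "outer n UNIV K' \<psi>'"
    and M': "inner_op n K' UNIV M'" and \<theta>': "\<And>x. \<theta> x = M' (\<psi>' x)"
  obtains U where "unitary_on K K' U" "\<And>x. \<psi>' x = (\<lambda>w. U (\<psi> x w))"
    "\<And>f. f \<in> fock n K \<Longrightarrow> (\<lambda>w. U (f w)) \<in> fock n K'"
    "\<And>f. f \<in> fock n K \<Longrightarrow> M f = M' (\<lambda>w. U (f w))"
proof -
  define P where "P x = Abs_l2 (\<psi> x)" for x
  define P' where "P' x = Abs_l2 (\<psi>' x)" for x
  define X where "X x = Abs_l2 (M (coef x))" for x
  define X' where "X' x = Abs_l2 (M' (coef x))" for x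
  note P = symop_Abs[OF \<psi>(1), folded P_def] and P' = symop_Abs[OF \<psi>'(1), folded P'_def]
  have X: "innerl n K UNIV X" and X': "innerl n K' UNIV X'"
    unfolding X_def X'_def by (rule innerl_Abs[OF M] innerl_Abs[OF M'])+
  have cX: "coef (X x) = M (coef x)" if "x \<in> fockl n K" for x
    unfolding X_def using fop_Abs(4)[of n K UNIV M] M that by (simp add: inner_op_def multi_analytic_def)
  have cX': "coef (X' x) = M' (coef x)" if "x \<in> fockl n K'" for x
    unfolding X'_def using fop_Abs(4)[of n K' UNIV M'] M' that by (simp add: inner_op_def multi_analytic_def)
  have XP: "X (P x) = X' (P' x)" for x
    unfolding X_def X'_def by (simp add: P(4) P'(4) \<theta>[symmetric] \<theta>'[symmetric])
  have "generated n P = fockl n K" "generated n P' = fockl n K'"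
    using outer_coef_iff[OF K P(1,2)] outer_coef_iff[OF K' P'(1,2)] \<psi>(2) \<psi>'(2) by (simp_all add: P(4) P'(4))
  \<comment> \<open>Outerness makes both ranges equal to the subspace generated by the common
    composite symbol.\<close>
  hence eq: "X ` fockl n K = X' ` fockl n K'"
    using generated_eq_fockl_iff[where \<psi>=P, OF X K P(2)]
      generated_eq_fockl_iff[where \<psi>=P', OF X' K' P'(2)] XP by simp
  obtain Z where Z: "innerl n K K' Z" "Z ` fockl n K = fockl n K'" "\<And>x. x \<in> fockl n K \<Longrightarrow> X' (Z x) = X x"
    by (rule innerl_inverse[OF X K X' K' eq]) blast
  obtain U where U: "unitary_on K K' U" "\<And>x w. x \<in> fockl n K \<Longrightarrow> coef (Z x) w = U (coef x w)"
    by (rule innerl_onto_unitary[OF Z(1,2) K K']) blast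
  have ZU: "coef (Z (Abs_l2 f)) = (\<lambda>w. U (f w))" if "f \<in> fock n K" for f
    using U(2)[OF fock_Abs[OF that]] by (auto simp: fock_coef_Abs[OF that])
  show ?thesis
  proof (rule that[OF U(1)])
    show "\<psi>' x = (\<lambda>w. U (\<psi> x w))" for x
    proof -
      have "X' (P' x) = X' (Z (P x))" using Z(3)[OF P(2)] XP by simp
      hence "P' x = Z (P x)"
        using inj_onD[OF innerl_inj_on[OF X' K']] P'(2) innerlD(2)[OF Z(1) P(2)] by blast
      hence "\<psi>' x = coef (Z (P x))" using P'(4) by metis
      thus ?thesis using U(2)[OF P(2)] P(4) by auto
    qed
    fix f assume f: "f \<in> fock n K"
    note fA = fock_Abs[OF f]
    have ZA: "Z (Abs_l2 f) \<in> fockl n K'" by (rule innerlD(2)[OF Z(1) fA])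
    thus "(\<lambda>w. U (f w)) \<in> fock n K'" using ZU[OF f] by (simp add: fockl_iff_fock)
    have "M f = coef (X (Abs_l2 f))" using cX[OF fA] by (simp add: fock_coef_Abs[OF f])
    also have "\<dots> = coef (X' (Z (Abs_l2 f)))" using Z(3)[OF fA] by simp
    also have "\<dots> = M' (\<lambda>w. U (f w))" using cX'[OF ZA] ZU[OF f] by simp
    finally show "M f = M' (\<lambda>w. U (f w))" .
  qed
qed

text \<open>Since \<open>X\<close> is isometric, the factor \<open>P\<close> inherits the bound of
  \<open>\<Theta>\<close>; it is outer because the range of \<open>X\<close> is exactly
  \<open>N\<close> and no larger.\<close>

lemma inner_outer_exists:
  fixes \<theta> :: "'a::chilbert \<Rightarrow> nat list \<Rightarrow> 'b::chilbert"
  assumes "symop n UNIV UNIV \<theta>"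
  shows "\<exists>(K :: 'a set) \<psi> M. csubspace K \<and> symop n UNIV K \<psi> \<and> outer n UNIV K \<psi>
          \<and> inner_op n K UNIV M \<and> (\<forall>x. \<theta> x = M (\<psi> x))"
proof -
  define \<Theta> where "\<Theta> x = Abs_l2 (\<theta> x)" for x
  note \<Theta> = symop_Abs[OF assms, folded \<Theta>_def]
  obtain C where C: "\<And>x. norm (\<Theta> x) \<le> C * norm x" using \<Theta>(3) by blast
  interpret fock_symbol n \<Theta> C by unfold_locales (use \<Theta> C in auto)
  obtain K :: "'a set" and X where K: "csubspace K" and X: "innerl n K UNIV X" and XN: "X ` fockl n K = N"
    using inner_operator_exists by blast
  obtain P where P: "lin_on UNIV P" "\<And>x. P x \<in> fockl n K" "\<And>x. X (P x) = \<Theta> x" "\<And>x. norm (P x) = norm (\<Theta> x)"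
    by (rule lin_on_factor[OF \<Theta>(1) csubspace_UNIV innerlD(1)[OF X] csubspace_fockl[OF K] innerlD(3)[OF X]])
       (use XN \<theta>_N in auto)
  have "symop n UNIV K (\<lambda>x. coef (P x))"
    by (rule symop_coef[OF P(1,2), of C]) (simp add: P(4) C)
  moreover have "generated n P = fockl n K"
    using generated_eq_fockl_iff[where \<psi>=P, OF X K P(2)] XN by (simp add: P(3))
  hence "outer n UNIV K (\<lambda>x. coef (P x))" using outer_coef_iff[OF K P(1,2)] by simp
  moreover have "\<theta> x = coef (X (Abs_l2 (coef (P x))))" for x
    by (simp add: coef_inverse P(3) \<Theta>(4))
  ultimately show ?thesis using K inner_op_coef[OF X] by blast
qed

section \<open>Factorization of multi-analytic operators\<close>

text \<open>On finitely supported vectors the operator produces finite sums of shifted symbol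
  values; continuity and density do the rest. This places the range of the whole operator, and not
  only of its symbol, inside the range of the inner factor.\<close>

lemma multi_analytic_in_generated:
  assumes M: "multi_analytic n UNIV L M" and x: "x \<in> fockl n UNIV"
  shows "Abs_l2 (M (coef x)) \<in> generated n (\<lambda>h. Abs_l2 (symbol M h))"
proof -
  define X where "X x = Abs_l2 (M (coef x))" for x
  define T where "T h = Abs_l2 (symbol M h)" for h
  have F: "fop n UNIV L M" using M by (simp add: multi_analytic_def)
  note X = fop_Abs(1,2)[OF F, folded X_def]
  obtain C where C: "\<And>x. x \<in> fockl n UNIV \<Longrightarrow> norm (X x) \<le> C * norm x"
    using fop_Abs(3)[OF F] unfolding X_def by blast
  note FU = csubspaceD(1)[OF csubspace_fockl[OF csubspace_UNIV, of n]]
  have X_sh: "X (fsh \<alpha> y) = fsh \<alpha> (X y)" if "\<alpha> \<in> words n" "y \<in> fockl n UNIV" for \<alpha> y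
    using that
  proof (induction \<alpha>)
    case (Cons i \<alpha>)
    thus ?case
      using multi_analytic_Abs_fsh[OF M, of i "fsh \<alpha> y"] fsh_fockl[OF csubspace_UNIV, of \<alpha> n y]
      by (simp add: X_def fsh_Cons[of i \<alpha>])
  qed simp
  have v: "fvac h \<in> fockl n UNIV" for h :: 'a by (rule fvac_fockl[OF csubspace_UNIV]) simp
  have Xv: "X (fvac h) = T h" for h by (simp add: X_def T_def symbol_def coef_fvac)
  let ?N = "generated n T"
  have "X y \<in> ?N" if y: "y \<in> fin_supp n UNIV" for y
  proof -
    let ?A = "{w. coef y w \<noteq> 0}"
    have A: "finite ?A" "?A \<subseteq> words n" using y by (auto simp: fin_supp_def fockl_def)
    have "y = (\<Sum>w\<in>?A. fsh w (fvac (coef y w)))"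
    proof (rule l2_eqI)
      show "coef y u = coef (\<Sum>w\<in>?A. fsh w (fvac (coef y w))) u" for u
        using A(1) by (simp add: coef_sum coef_fsh_fvac)
    qed
    hence "X y = X (\<Sum>w\<in>?A. fsh w (fvac (coef y w)))" by simp
    also have "\<dots> = (\<Sum>w\<in>?A. X (fsh w (fvac (coef y w))))"
      using A(2) fsh_fockl[OF csubspace_UNIV _ v] by (intro lin_on_sum[OF X(1) FU]) auto
    also have "\<dots> = (\<Sum>w\<in>?A. fsh w (T (coef y w)))"
      using A(2) by (intro sum.cong refl) (auto simp: X_sh v Xv)
    also have "\<dots> \<in> span (\<Union>\<alpha>\<in>words n. fsh \<alpha> ` range T)"
      using A(2) by (intro span_sum span_base) blast
    finally show ?thesis unfolding generated_def using closure_subset by blast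
  qed
  hence sub: "X ` fin_supp n UNIV \<subseteq> ?N" by blast
  have cont: "continuous_on (fockl n UNIV) X"
  proof (rule lipschitz_on_continuous_on)
    \<comment> \<open>A Lipschitz constant has to be nonnegative, which \<open>C\<close> need not
      be.\<close>
    show "(max C 0)-lipschitz_on (fockl n UNIV) X"
    proof (rule lipschitz_onI)
      fix x y :: "'a fockspace" assume xy: "x \<in> fockl n UNIV" "y \<in> fockl n UNIV"
      have "norm (X (x - y)) \<le> C * norm (x - y)" by (rule C[OF subspace_diff[OF FU xy]])
      also have "\<dots> \<le> max C 0 * norm (x - y)" by (intro mult_right_mono) auto
      finally show "dist (X x) (X y) \<le> max C 0 * dist x y"
        by (simp add: dist_norm lin_on_diff[OF X(1) FU xy])
    qed simp
  qed
  have "X ` closure (fin_supp n UNIV) \<subseteq> ?N"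
    by (rule image_closure_subset) (use cont sub in \<open>auto simp: closure_fin_supp[OF csubspace_UNIV] generated_def\<close>)
  thus ?thesis using x unfolding X_def T_def closure_fin_supp[OF csubspace_UNIV] by blast
qed

text \<open>The operator itself is lifted through \<open>X\<close>. Lifting only its symbol would
  not suffice, because a bounded symbol need not extend to a bounded operator on the Fock space,
  whereas \<open>norm (Z x) = norm (A x)\<close> preserves the bound.\<close>

lemma inner_outer_multi_analytic_exists:
  fixes M :: "(nat list \<Rightarrow> 'a::chilbert) \<Rightarrow> nat list \<Rightarrow> 'b::chilbert"
  assumes M: "multi_analytic n UNIV UNIV M"
  shows "\<exists>(K :: 'a set) P X. csubspace K \<and> multi_analytic n UNIV K P \<and> outer n UNIV K (symbol P)
          \<and> inner_op n K UNIV X \<and> (\<forall>f\<in>fock n UNIV. M f = X (P f))"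
proof -
  define A where "A x = Abs_l2 (M (coef x))" for x
  define \<Theta> where "\<Theta> h = Abs_l2 (symbol M h)" for h
  have F: "fop n UNIV UNIV M" using M by (simp add: multi_analytic_def)
  note A = fop_Abs[OF F, folded A_def] and \<Theta> = symop_Abs[OF symop_symbol[OF M], folded \<Theta>_def]
  note FU = csubspace_fockl[OF csubspace_UNIV, of n]
  obtain B where B: "\<And>x. x \<in> fockl n UNIV \<Longrightarrow> norm (A x) \<le> B * norm x" using A(3) by blast
  obtain C where C: "\<And>x. norm (\<Theta> x) \<le> C * norm x" using \<Theta>(3) by blast
  interpret fock_symbol n \<Theta> C by unfold_locales (use \<Theta> C in auto)
  obtain K :: "'a set" and X where K: "csubspace K" and X: "innerl n K UNIV X" and XN: "X ` fockl n K = N"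
    using inner_operator_exists by blast
  have "A ` fockl n UNIV \<subseteq> X ` fockl n K"
    unfolding XN using multi_analytic_in_generated[OF M, folded A_def \<Theta>_def] by auto
  then obtain Z where Z: "lin_on (fockl n UNIV) Z" "\<And>x. x \<in> fockl n UNIV \<Longrightarrow> Z x \<in> fockl n K"
    "\<And>x. x \<in> fockl n UNIV \<Longrightarrow> X (Z x) = A x" "\<And>x. x \<in> fockl n UNIV \<Longrightarrow> norm (Z x) = norm (A x)"
    using lin_on_factor[OF A(1) FU innerlD(1)[OF X] csubspace_fockl[OF K] innerlD(3)[OF X]] by metis
  have Z_sh: "Z (fsh [i] x) = fsh [i] (Z x)" if i: "i < n" and x: "x \<in> fockl n UNIV" for i x
  proof (rule inj_onD[OF innerl_inj_on[OF X K]])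
    have sx: "fsh [i] x \<in> fockl n UNIV" using fsh_fockl[OF csubspace_UNIV _ x, of "[i]"] i by simp
    show "X (Z (fsh [i] x)) = X (fsh [i] (Z x))"
      using multi_analytic_Abs_fsh[OF M i x] innerlD(4)[OF X i Z(2)[OF x]]
      by (simp add: Z(3)[OF sx] Z(3)[OF x] A_def)
    show "Z (fsh [i] x) \<in> fockl n K" by (rule Z(2)[OF sx])
    show "fsh [i] (Z x) \<in> fockl n K" using fsh_fockl[OF K _ Z(2)[OF x], of "[i]"] i by simp
  qed
  define P where "P f = coef (Z (Abs_l2 f))" for f
  have P: "multi_analytic n UNIV K P"
    unfolding P_def[abs_def]
    by (rule multi_analytic_coef[OF Z(1,2), of B]) (use Z(4) B Z_sh in auto)
  have v: "fvac h \<in> fockl n UNIV" for h :: 'a by (rule fvac_fockl[OF csubspace_UNIV]) simp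
  have symb: "symbol P = (\<lambda>h. coef (Z (fvac h)))"
    by (simp add: symbol_def P_def Abs_vac)
  have lin: "lin_on UNIV (\<lambda>h. Z (fvac h))"
    using lin_onD[OF Z(1)] v by (simp add: lin_on_def fvac_add fvac_scaleR fvac_cJ)
  have "X (Z (fvac h)) = \<Theta> h" for h
    by (simp add: Z(3)[OF v] A_def \<Theta>_def symbol_def coef_fvac)
  hence "generated n (\<lambda>h. Z (fvac h)) = fockl n K"
    using generated_eq_fockl_iff[where \<psi>="\<lambda>h. Z (fvac h)", OF X K Z(2)[OF v]] XN by simp
  hence "outer n UNIV K (symbol P)"
    unfolding symb using outer_coef_iff[OF K lin Z(2)[OF v]] by simp
  moreover have "M f = coef (X (Abs_l2 (P f)))" if "f \<in> fock n UNIV" for f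
    using Z(3)[OF fock_Abs[OF that]] A(4)[OF fock_Abs[OF that]]
    by (simp add: P_def coef_inverse fock_coef_Abs[OF that])
  ultimately show ?thesis using K P inner_op_coef[OF X] by blast
qed

lemma inner_op_inj_on:
  assumes M: "inner_op n K L M" and K: "csubspace K" and fg: "f \<in> fock n K" "g \<in> fock n K" "M f = M g"
  shows "f = g"
proof -
  have "Abs_l2 f = Abs_l2 g"
    using inj_onD[OF innerl_inj_on[OF innerl_Abs[OF M] K] _ fock_Abs[OF fg(1)] fock_Abs[OF fg(2)]] fg
    by (simp add: fock_coef_Abs)
  thus ?thesis using fock_coef_Abs[OF fg(1)] fock_coef_Abs[OF fg(2)] by metis
qed

text \<open>The unitary comes from the symbols. The relation between the full outer operators then
  follows by cancelling the injective \<open>M'\<close>, with no extension from vacuum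
  vectors.\<close>

lemma inner_outer_multi_analytic_unique:
  fixes K :: "'c::chilbert set" and K' :: "'d::chilbert set"
    and A :: "(nat list \<Rightarrow> 'a::chilbert) \<Rightarrow> nat list \<Rightarrow> 'b::chilbert"
  assumes K: "csubspace K" and P: "multi_analytic n UNIV K P" "outer n UNIV K (symbol P)"
    and M: "inner_op n K UNIV M" and A: "\<forall>f\<in>fock n UNIV. A f = M (P f)"
    and K': "csubspace K'" and P': "multi_analytic n UNIV K' P'" "outer n UNIV K' (symbol P')"
    and M': "inner_op n K' UNIV M'" and A': "\<forall>f\<in>fock n UNIV. A f = M' (P' f)"
  shows "\<exists>U. unitary_on K K' U \<and> (\<forall>f\<in>fock n UNIV. P' f = (\<lambda>w. U (P f w)))
           \<and> (\<forall>f\<in>fock n K. M f = M' (\<lambda>w. U (f w)))"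
proof -
  have v: "vac h \<in> fock n UNIV" for h :: 'a
    using fvac_fockl[OF csubspace_UNIV, of h n] by (simp add: fockl_iff_fock coef_fvac)
  have "symbol A x = M (symbol P x)" "symbol A x = M' (symbol P' x)" for x
    using A A' v by (auto simp: symbol_def)
  then obtain U where U: "unitary_on K K' U"
    and UF: "\<And>f. f \<in> fock n K \<Longrightarrow> (\<lambda>w. U (f w)) \<in> fock n K'"
    and UM: "\<And>f. f \<in> fock n K \<Longrightarrow> M f = M' (\<lambda>w. U (f w))"
    using inner_outer_unique[OF K symop_symbol[OF P(1)] P(2) M _ K' symop_symbol[OF P'(1)] P'(2) M']
    by metis
  have "P' f = (\<lambda>w. U (P f w))" if f: "f \<in> fock n UNIV" for f
  proof (rule inner_op_inj_on[OF M' K'])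
    have Pf: "P f \<in> fock n K" using P(1) f by (simp add: multi_analytic_def fop_def)
    show "P' f \<in> fock n K'" using P'(1) f by (simp add: multi_analytic_def fop_def)
    show "(\<lambda>w. U (P f w)) \<in> fock n K'" by (rule UF[OF Pf])
    show "M' (P' f) = M' (\<lambda>w. U (P f w))" using A A' f UM[OF Pf] by simp
  qed
  thus ?thesis using U UM by blast
qed

theorem mainTheorem6:
  fixes n :: nat
    and \<theta> :: "'a::chilbert \<Rightarrow> nat list \<Rightarrow> 'b::chilbert"
    and M\<theta> :: "(nat list \<Rightarrow> 'a) \<Rightarrow> (nat list \<Rightarrow> 'b)"
  assumes "1 \<le> n"
  shows
   "((\<exists>S. finite S \<and> span S = (UNIV :: 'a set)) \<and> symop n UNIV UNIV \<theta> \<longrightarrow>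
      (\<exists>(K3 :: 'a set) \<psi> M\<chi>. csubspace K3 \<and> symop n UNIV K3 \<psi> \<and> outer n UNIV K3 \<psi>
          \<and> inner_op n K3 UNIV M\<chi> \<and> (\<forall>x. \<theta> x = M\<chi> (\<psi> x)))
    \<and> (\<forall>(K3 :: 'c::chilbert set) \<psi> M\<chi> (K3' :: 'd::chilbert set) \<psi>' M\<chi>'.
          csubspace K3 \<and> symop n UNIV K3 \<psi> \<and> outer n UNIV K3 \<psi>
          \<and> inner_op n K3 UNIV M\<chi> \<and> (\<forall>x. \<theta> x = M\<chi> (\<psi> x))
        \<and> csubspace K3' \<and> symop n UNIV K3' \<psi>' \<and> outer n UNIV K3' \<psi>'
          \<and> inner_op n K3' UNIV M\<chi>' \<and> (\<forall>x. \<theta> x = M\<chi>' (\<psi>' x))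
        \<longrightarrow> (\<exists>U. unitary_on K3 K3' U \<and> (\<forall>x. \<psi>' x = (\<lambda>w. U (\<psi> x w)))
                 \<and> (\<forall>f\<in>fock n K3. M\<chi> f = M\<chi>' (\<lambda>w. U (f w))))))
  \<and> (multi_analytic n UNIV UNIV M\<theta> \<longrightarrow>
      (\<exists>(K3 :: 'a set) M\<psi> M\<chi>. csubspace K3 \<and> multi_analytic n UNIV K3 M\<psi>
          \<and> outer n UNIV K3 (symbol M\<psi>) \<and> inner_op n K3 UNIV M\<chi>
          \<and> (\<forall>f\<in>fock n UNIV. M\<theta> f = M\<chi> (M\<psi> f)))
    \<and> (\<forall>(K3 :: 'c::chilbert set) M\<psi> M\<chi> (K3' :: 'd::chilbert set) M\<psi>' M\<chi>'.
          csubspace K3 \<and> multi_analytic n UNIV K3 M\<psi>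
          \<and> outer n UNIV K3 (symbol M\<psi>) \<and> inner_op n K3 UNIV M\<chi>
          \<and> (\<forall>f\<in>fock n UNIV. M\<theta> f = M\<chi> (M\<psi> f))
        \<and> csubspace K3' \<and> multi_analytic n UNIV K3' M\<psi>'
          \<and> outer n UNIV K3' (symbol M\<psi>') \<and> inner_op n K3' UNIV M\<chi>'
          \<and> (\<forall>f\<in>fock n UNIV. M\<theta> f = M\<chi>' (M\<psi>' f))
        \<longrightarrow> (\<exists>U. unitary_on K3 K3' U
                 \<and> (\<forall>f\<in>fock n UNIV. M\<psi>' f = (\<lambda>w. U (M\<psi> f w)))
                 \<and> (\<forall>f\<in>fock n K3. M\<chi> f = M\<chi>' (\<lambda>w. U (f w))))))"
  apply (intro conjI impI allI; (elim conjE)?)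
  subgoal by (rule inner_outer_exists)
  subgoal for K3 \<psi> M K3' \<psi>' M'
    by (rule inner_outer_unique[of K3 n \<psi> M \<theta> K3' \<psi>' M']) (auto intro: exI)
  subgoal by (rule inner_outer_multi_analytic_exists)
  subgoal for K3 P M K3' P' M'
    by (rule inner_outer_multi_analytic_unique)
  done

end
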